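(* Let $b>0$ and let $V\in M$, the space of finite signed measures on $(-b,b)$. Assume $u\in W_0^{1,2}(-b,b)$ is a nontrivial distributional solution of $-u''=Vu$ on $(-b,b)$. Then $$b\,\|V\|_M\ \ge\ 2 .$$ Equality is attained when $u(x)=1-\frac{|x|}b$. Equality is not possible with $V\in L^1(-b,b)$, but the inequality is still sharp in this case (i.e. the constant $2$ cannot be replaced by a larger one when $V$ is restricted to $L^1(-b,b)$).
   Context: $W^{1,2}_0(-b,b)$ is the closure of $C_0^\infty(-b,b)$ with respect to $\|u'\|_2$; its elements are continuous functions on $[-b,b]$ vanishing at $\pm b$. $M$ is the space of signed measures $V$ on $(-b,b)$ with $\|V\|_M=|V|((-b,b))<\infty$, where $|V|$ is the total variation measure; a function $V\in L^1(-b,b)$ is identified with the measure $V\,dx$, so $\|V\|_M=\|V\|_1$. Distributional solution means $\int_{-b}^bu'\psi'\,dx=\int_{(-b,b)}u\psi\,dV$ for all $\psi\in C_0^\infty(-b,b)$; nontrivial means not identically zero. *)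

theory Defs
  imports "HOL-Analysis.Analysis"
begin

definition signed_measure :: "'a measure \<Rightarrow> ('a set \<Rightarrow> real) \<Rightarrow> bool" where
  "signed_measure M V \<longleftrightarrow>
     V {} = 0 \<and>
     (\<forall>A :: nat \<Rightarrow> 'a set. range A \<subseteq> sets M \<longrightarrow> disjoint_family A \<longrightarrow>
        (\<lambda>i. V (A i)) sums V (\<Union>i. A i))"

definition total_variation :: "'a measure \<Rightarrow> ('a set \<Rightarrow> real) \<Rightarrow> 'a set \<Rightarrow> ennreal" where
  "total_variation M V E =
     (SUP A \<in> {A :: nat \<Rightarrow> 'a set. range A \<subseteq> sets M \<and> disjoint_family A \<and> (\<Union>i. A i) = E}.
        \<Sum>i. ennreal \<bar>V (A i)\<bar>)"

text \<open>The Jordan decomposition: the positive and negative parts are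
  \<open>(\<bar>V\<bar> + V) / 2\<close> and \<open>(\<bar>V\<bar> - V) / 2\<close>, where \<open>\<bar>V\<bar>\<close> is the total variation measure. They are
  meaningful only for a signed measure \<open>V\<close> of finite total variation.\<close>

definition positive_part :: "'a measure \<Rightarrow> ('a set \<Rightarrow> real) \<Rightarrow> 'a measure" where
  "positive_part M V =
     measure_of (space M) (sets M) (\<lambda>A. ennreal ((enn2real (total_variation M V A) + V A) / 2))"

definition negative_part :: "'a measure \<Rightarrow> ('a set \<Rightarrow> real) \<Rightarrow> 'a measure" where
  "negative_part M V =
     measure_of (space M) (sets M) (\<lambda>A. ennreal ((enn2real (total_variation M V A) - V A) / 2))"

definition signed_integral :: "'a measure \<Rightarrow> ('a set \<Rightarrow> real) \<Rightarrow> ('a \<Rightarrow> real) \<Rightarrow> real" where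
  "signed_integral M V f =
     integral\<^sup>L (positive_part M V) f - integral\<^sup>L (negative_part M V) f"

abbreviation borel_interval :: "real \<Rightarrow> real measure" where
  "borel_interval b \<equiv> restrict_space borel {-b<..<b}"

definition finite_signed_measures :: "real \<Rightarrow> (real set \<Rightarrow> real) set" where
  "finite_signed_measures b =
     {V. signed_measure (borel_interval b) V \<and>
         total_variation (borel_interval b) V {-b<..<b} < \<infinity>}"

definition norm_M :: "real \<Rightarrow> (real set \<Rightarrow> real) \<Rightarrow> real" where
  "norm_M b V = enn2real (total_variation (borel_interval b) V {-b<..<b})"

text \<open>The signed measure \<open>f dx\<close> with which an integrable function \<open>f\<close> is identified.\<close>

definition density_signed_measure :: "(real \<Rightarrow> real) \<Rightarrow> real set \<Rightarrow> real" where
  "density_signed_measure f A = (LINT x:A|lebesgue. f x)"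

definition L1 :: "real \<Rightarrow> (real \<Rightarrow> real) set" where
  "L1 b = {f. set_integrable lebesgue {-b<..<b} f}"

definition L2 :: "real \<Rightarrow> (real \<Rightarrow> real) set" where
  "L2 b = {v. set_borel_measurable lebesgue {-b<..<b} v \<and>
              set_integrable lebesgue {-b<..<b} (\<lambda>x. (v x)\<^sup>2)}"

definition norm_L2 :: "real \<Rightarrow> (real \<Rightarrow> real) \<Rightarrow> real" where
  "norm_L2 b v = sqrt (LINT x:{-b<..<b}|lebesgue. (v x)\<^sup>2)"

text \<open>\<open>C\<^sub>0\<^sup>\<infinity>(-b,b)\<close>: functions are extended by zero to the whole line, and the closed subset
  \<open>closure {x. \<psi> x \<noteq> 0}\<close> of the bounded interval is automatically compact.\<close>

definition test_functions :: "real \<Rightarrow> (real \<Rightarrow> real) set" where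
  "test_functions b =
     {\<psi>. (\<forall>n x. (deriv ^^ n) \<psi> differentiable (at x)) \<and> closure {x. \<psi> x \<noteq> 0} \<subseteq> {-b<..<b}}"

definition weak_derivative_L2 :: "real \<Rightarrow> (real \<Rightarrow> real) \<Rightarrow> (real \<Rightarrow> real) \<Rightarrow> bool" where
  "weak_derivative_L2 b u v \<longleftrightarrow>
     v \<in> L2 b \<and>
     (\<forall>\<psi>\<in>test_functions b.
        (LINT x:{-b<..<b}|lebesgue. u x * deriv \<psi> x) = - (LINT x:{-b<..<b}|lebesgue. v x * \<psi> x))"

text \<open>\<open>W\<^sub>0\<^sup>1\<^sup>,\<^sup>2(-b,b)\<close> as the closure of the test functions in \<open>\<parallel>u'\<parallel>\<^sub>2\<close>, taken among the continuous
  functions on \<open>[-b,b]\<close> that vanish at \<open>-b\<close> and \<open>b\<close> and have a weak derivative in \<open>L\<^sup>2\<close>; without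
  the boundary values \<open>\<parallel>u'\<parallel>\<^sub>2\<close> would only be a seminorm. Each element is represented by its
  continuous representative, whose values outside \<open>[-b,b]\<close> are irrelevant.\<close>

definition W012 :: "real \<Rightarrow> (real \<Rightarrow> real) set" where
  "W012 b =
     {u. continuous_on {-b..b} u \<and> u (-b) = 0 \<and> u b = 0 \<and>
         (\<exists>v. weak_derivative_L2 b u v \<and>
              (\<forall>\<epsilon>>0. \<exists>\<phi>\<in>test_functions b. norm_L2 b (\<lambda>x. v x - deriv \<phi> x) < \<epsilon>))}"

text \<open>The weak derivative is unique up to null sets, so the choice of \<open>v\<close> does not matter.\<close>

definition distributional_solution :: "real \<Rightarrow> (real set \<Rightarrow> real) \<Rightarrow> (real \<Rightarrow> real) \<Rightarrow> bool" where
  "distributional_solution b V u \<longleftrightarrow>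
     (\<exists>v. weak_derivative_L2 b u v \<and>
          (\<forall>\<psi>\<in>test_functions b.
             (LINT x:{-b<..<b}|lebesgue. v x * deriv \<psi> x) =
             signed_integral (borel_interval b) V (\<lambda>x. u x * \<psi> x)))"

definition nontrivial_solution :: "real \<Rightarrow> (real set \<Rightarrow> real) \<Rightarrow> (real \<Rightarrow> real) \<Rightarrow> bool" where
  "nontrivial_solution b V u \<longleftrightarrow>
     u \<in> W012 b \<and> (\<exists>x\<in>{-b<..<b}. u x \<noteq> 0) \<and> distributional_solution b V u"

end

(* If u solves the equation with weak derivative v, testing with u gives
   K = \<integral> v\<^sup>2 = \<integral> u\<^sup>2 dV \<le> \<integral> u\<^sup>2 dV\<^sup>+. The representation of u(x) as an L\<^sup>2 inner product of v with a kernel of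
   square norm (b\<^sup>2 - x\<^sup>2) / (2 b) bounds u(x)\<^sup>2 by K (b\<^sup>2 - x\<^sup>2) / (2 b), so
   2 b \<le> \<integral> (b\<^sup>2 - x\<^sup>2) dV\<^sup>+ \<le> b\<^sup>2 \<parallel>V\<parallel>, and equality would concentrate V\<^sup>+ at the origin, which no
   function in L\<^sup>1 allows. The tent 1 - |x| / b solves the equation with V = (2 / b) \<delta>_0. Smoothing its
   corner on [-e, e] gives a solution whose potential is a function of L\<^sup>1 norm at most 2 / (b - 3 e). *)

theory Submission
  imports Defs "HOL-Probability.Giry_Monad"
begin

section \<open>Signed measures and their total variation\<close>

text \<open>The equation may be tested only with test functions, and \<open>u\<close> is not one, so
  it enters as a limit of test functions whose derivatives converge to v in L^2. The kernel has norm
  at most \<open>sqrt b\<close> at every point, which upgrades this to uniform convergence and so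
  handles the right-hand side for every finite V, however singular. The price is that the uniform
  limit must be identified with \<open>u\<close>: both have the weak derivative v, and a du
  Bois-Reymond argument together with the boundary values closes the gap. The signed V enters the
  bound only through its positive part, whose mass is at most the norm; the Jordan decomposition is
  built directly on the total variation, without a Hahn decomposition. The function b^2 - x^2
  attains its maximum only at 0, which is why an optimal measure must sit there. For the examples,
  membership in \<open>W012 b\<close> demands smooth, compactly supported approximations. All of
  them come from one mollified sign function: it is the slope of the smoothed tent and the cut-off
  near the end points, and its derivative is the bump of the du Bois-Reymond argument.\<close>

abbreviation partitions :: "'a measure \<Rightarrow> 'a set \<Rightarrow> (nat \<Rightarrow> 'a set) set" where
  "partitions M E \<equiv> {A. range A \<subseteq> sets M \<and> disjoint_family A \<and> (\<Union>i. A i) = E}"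

lemma total_variation_upper:
  assumes "range A \<subseteq> sets M" "disjoint_family A" "(\<Union>i. A i) = E"
  shows "(\<Sum>i. ennreal \<bar>V (A i)\<bar>) \<le> total_variation M V E"
  unfolding total_variation_def using assms by (intro SUP_upper) auto

lemma trivial_partition:
  assumes "E \<in> sets M"
  shows "(\<lambda>i::nat. if i = 0 then E else {}) \<in> partitions M E"
  using assms by (auto simp: disjoint_family_on_def split: if_splits)

lemma abs_le_total_variation:
  assumes "E \<in> sets M" "V {} = 0"
  shows "ennreal \<bar>V E\<bar> \<le> total_variation M V E"
proof -
  let ?A = "\<lambda>i::nat. if i = 0 then E else {}"
  have "(\<Sum>i. ennreal \<bar>V (?A i)\<bar>) = (\<Sum>i\<in>{0}. ennreal \<bar>V (?A i)\<bar>)"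
    using assms by (intro suminf_finite) auto
  then show ?thesis
    using total_variation_upper[of ?A M E V] trivial_partition[OF assms(1)] by simp
qed

lemma signed_measure_empty: "signed_measure M V \<Longrightarrow> V {} = 0"
  by (simp add: signed_measure_def)

lemma signed_measure_sums:
  "signed_measure M V \<Longrightarrow> range A \<subseteq> sets M \<Longrightarrow> disjoint_family A \<Longrightarrow> (\<lambda>i. V (A i)) sums V (\<Union>i. A i)"
  by (simp add: signed_measure_def)

text \<open>A partition of A and one of B merge into a partition of the union, so the supremum over
  the union is at least the sum of the two suprema.\<close>

lemma total_variation_superadd:
  assumes "A \<in> sets M" "B \<in> sets M" "A \<inter> B = {}" "V {} = 0"
  shows "total_variation M V A + total_variation M V B \<le> total_variation M V (A \<union> B)"
proof -
  have neA: "partitions M A \<noteq> {}" and neB: "partitions M B \<noteq> {}"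
    using trivial_partition[OF assms(1)] trivial_partition[OF assms(2)] by (metis empty_iff)+
  have "(\<Sum>i. ennreal \<bar>V (F i)\<bar>) + (\<Sum>i. ennreal \<bar>V (G i)\<bar>) \<le> total_variation M V (A \<union> B)"
    if F: "F \<in> partitions M A" and G: "G \<in> partitions M B" for F G
  proof -
    \<comment> \<open>Rows 0 and 1 of a doubly indexed family hold the two partitions and all other
      rows are empty; \<open>prod_decode\<close> lists the family as one sequence.\<close>
    define P where "P = (\<lambda>(i::nat, j). if i = 0 then F j else if i = 1 then G j else {})"
    define C where "C = (\<lambda>n. P (prod_decode n))"
    have disjFG: "F i \<inter> G j = {}" for i j
      using F G assms(3) by auto
    have dF: "F i \<inter> F j = {}" and dG: "G i \<inter> G j = {}" if "i \<noteq> j" for i j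
      using F G that by (auto simp: disjoint_family_on_def)
    have dP: "P p \<inter> P q = {}" if "p \<noteq> q" for p q
      proof (cases p, cases q)
      fix i j k l assume "p = (i, j)" "q = (k, l)"
      then show ?thesis
        using that disjFG[of j l] disjFG[of l j] dF[of j l] dG[of j l]
        by (auto simp: P_def Int_commute)
    qed
    have 1: "disjoint_family C"
      unfolding disjoint_family_on_def C_def using dP by (metis prod_decode_eq)
    have 2: "range C \<subseteq> sets M"
      using F G by (auto simp: C_def P_def split: prod.splits)
    have "(\<Union>n. C n) = (\<Union>p. P p)"
      unfolding C_def using surj_prod_decode by (metis image_image)
    also have "\<dots> = A \<union> B"
    proof
      show "(\<Union>p. P p) \<subseteq> A \<union> B"
        using F G by (auto simp: P_def split: if_splits)
      show "A \<union> B \<subseteq> (\<Union>p. P p)"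
      proof
        fix x assume "x \<in> A \<union> B"
        then obtain j where "x \<in> F j \<or> x \<in> G j" using F G by auto
        then have "x \<in> P (0, j) \<or> x \<in> P (1, j)" by (simp add: P_def)
        then show "x \<in> (\<Union>p. P p)" by blast
      qed
    qed
    finally have 3: "(\<Union>n. C n) = A \<union> B" .
    have "(\<Sum>n. ennreal \<bar>V (C n)\<bar>) = (\<Sum>i. \<Sum>j. ennreal \<bar>V (P (i, j))\<bar>)"
      unfolding C_def
      by (rule suminf_ennreal_2dimen[where f = "\<lambda>p. ennreal \<bar>V (P p)\<bar>", unfolded comp_def]) (rule refl)
    also have "\<dots> = (\<Sum>i\<in>{0,1}. \<Sum>j. ennreal \<bar>V (P (i, j))\<bar>)"
      using assms(4) by (intro suminf_finite) (auto simp: P_def)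
    also have "\<dots> = (\<Sum>i. ennreal \<bar>V (F i)\<bar>) + (\<Sum>i. ennreal \<bar>V (G i)\<bar>)"
      by (simp add: P_def)
    finally show ?thesis
      using total_variation_upper[OF 2 1 3, of V] by simp
  qed
  \<comment> \<open>The two suprema are pulled out of the sum one at a time, which requires each set
    of partitions to be nonempty.\<close>
  then show ?thesis
    unfolding total_variation_def[of M V A] total_variation_def[of M V B]
    apply (subst ennreal_SUP_add_left[OF neA, symmetric])
    apply (rule SUP_least)
    apply (subst ennreal_SUP_add_right[OF neB])
    apply (rule SUP_least)
    by blast
qed

lemma total_variation_mono:
  assumes "A \<in> sets M" "B \<in> sets M" "A \<subseteq> B" "V {} = 0"
  shows "total_variation M V A \<le> total_variation M V B"
proof -
  have "total_variation M V A + total_variation M V (B - A) \<le> total_variation M V (A \<union> (B - A))"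
    using assms by (intro total_variation_superadd) auto
  moreover have "A \<union> (B - A) = B" using assms by auto
  ultimately show ?thesis
    by (metis add_increasing2 order_trans order_refl zero_le)
qed

lemma total_variation_sum_le:
  assumes "range A \<subseteq> sets M" "disjoint_family A" "V {} = 0"
  shows "(\<Sum>i<n. total_variation M V (A i)) \<le> total_variation M V (\<Union>i<n::nat. A i)"
proof (induction n)
  case (Suc n)
  have "(\<Sum>i<Suc n. total_variation M V (A i))
      \<le> total_variation M V (\<Union>i<n. A i) + total_variation M V (A n)"
    using Suc by (simp add: add_right_mono)
  also have "\<dots> \<le> total_variation M V ((\<Union>i<n. A i) \<union> A n)"
  proof (rule total_variation_superadd)
    show "(\<Union>i<n. A i) \<inter> A n = {}"
      using disjoint_family_onD[OF assms(2), of _ n] by (auto simp: disjoint_iff nat_neq_iff)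
  qed (use assms in auto)
  also have "(\<Union>i<n. A i) \<union> A n = (\<Union>i<Suc n. A i)"
    by (auto simp: lessThan_Suc)
  finally show ?case .
qed simp

text \<open>Superadditivity bounds every partial sum by the variation of the union. For the
  converse, each piece of a partition of the union is cut along the sets \<open>A i\<close>, and the
  resulting double series is summed in the other order.\<close>

lemma total_variation_countably_additive:
  assumes V: "signed_measure M V"
  shows "countably_additive (sets M) (total_variation M V)"
proof (rule countably_additiveI)
  fix A :: "nat \<Rightarrow> 'a set"
  assume A: "range A \<subseteq> sets M" "disjoint_family A" and UA: "(\<Union>i. A i) \<in> sets M"
  have V0: "V {} = 0" using V by (rule signed_measure_empty)
  show "(\<Sum>i. total_variation M V (A i)) = total_variation M V (\<Union>i. A i)"
  proof (rule antisym)
    have "(\<Sum>i<n. total_variation M V (A i)) \<le> total_variation M V (\<Union>i. A i)" for n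
    proof -
      have "total_variation M V (\<Union>i<n. A i) \<le> total_variation M V (\<Union>i. A i)"
      proof (rule total_variation_mono)
        show "(\<Union>i<n. A i) \<in> sets M" using A by (intro sets.finite_UN) auto
      qed (use UA V0 in auto)
      then show ?thesis
        using total_variation_sum_le[OF A, of V, OF V0] order_trans by blast
    qed
    then show "(\<Sum>i. total_variation M V (A i)) \<le> total_variation M V (\<Union>i. A i)"
      by (intro suminf_le_const) auto
  next
    have "(\<Sum>j. ennreal \<bar>V (B j)\<bar>) \<le> (\<Sum>i. total_variation M V (A i))"
      if B: "B \<in> partitions M (\<Union>i. A i)" for B
    proof -
      have dA: "A i \<inter> A j = {}" and dB: "B i \<inter> B j = {}" if "i \<noteq> j" for i j
        using A B that by (auto simp: disjoint_family_on_def)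
      \<comment> \<open>Triangle inequality for an infinite sum: V of the piece is the limit of
        partial sums over its cuts, each bounded by the series of moduli.\<close>
      have *: "ennreal \<bar>V (B j)\<bar> \<le> (\<Sum>i. ennreal \<bar>V (B j \<inter> A i)\<bar>)" for j
      proof -
        have r: "range (\<lambda>i. B j \<inter> A i) \<subseteq> sets M" using A B by auto
        have "disjoint_family (\<lambda>i. B j \<inter> A i)"
          using dA unfolding disjoint_family_on_def by blast
        from signed_measure_sums[OF V r this]
        have "(\<lambda>i. V (B j \<inter> A i)) sums V (\<Union>i. B j \<inter> A i)" .
        moreover have "(\<Union>i. B j \<inter> A i) = B j" using B by auto
        ultimately have s: "(\<lambda>i. V (B j \<inter> A i)) sums V (B j)" by simp
        have "(\<lambda>n. ennreal \<bar>\<Sum>i<n. V (B j \<inter> A i)\<bar>) \<longlonglongrightarrow> ennreal \<bar>V (B j)\<bar>"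
          using s unfolding sums_def by (intro tendsto_ennrealI tendsto_rabs)
        moreover have "ennreal \<bar>\<Sum>i<n. V (B j \<inter> A i)\<bar> \<le> (\<Sum>i. ennreal \<bar>V (B j \<inter> A i)\<bar>)" for n
        proof -
          have "ennreal \<bar>\<Sum>i<n. V (B j \<inter> A i)\<bar> \<le> ennreal (\<Sum>i<n. \<bar>V (B j \<inter> A i)\<bar>)"
            by (intro ennreal_leI sum_abs)
          also have "\<dots> = (\<Sum>i<n. ennreal \<bar>V (B j \<inter> A i)\<bar>)"
            by simp
          also have "\<dots> \<le> (\<Sum>i. ennreal \<bar>V (B j \<inter> A i)\<bar>)"
            by (intro sum_le_suminf) auto
          finally show ?thesis .
        qed
        ultimately show ?thesis
          by (intro LIMSEQ_le_const2) blast+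
      qed
      have "(\<Sum>j. ennreal \<bar>V (B j)\<bar>) \<le> (\<Sum>j. \<Sum>i. ennreal \<bar>V (B j \<inter> A i)\<bar>)"
        by (intro suminf_le *) auto
      \<comment> \<open>Interchange of sums, read as termwise integration of a series with respect
        to counting measure.\<close>
      also have "\<dots> = (\<Sum>i. \<Sum>j. ennreal \<bar>V (B j \<inter> A i)\<bar>)"
        using nn_integral_suminf[of "\<lambda>i j. ennreal \<bar>V (B j \<inter> A i)\<bar>" "count_space UNIV"]
        unfolding nn_integral_count_space_nat by (rule meta_mp) measurable
      also have "\<dots> \<le> (\<Sum>i. total_variation M V (A i))"
      proof (intro suminf_le)
        fix i
        have "disjoint_family (\<lambda>j. B j \<inter> A i)"
          using dB unfolding disjoint_family_on_def by blast
        moreover have "(\<Union>j. B j \<inter> A i) = A i" using B by auto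
        ultimately show "(\<Sum>j. ennreal \<bar>V (B j \<inter> A i)\<bar>) \<le> total_variation M V (A i)"
          using A B by (intro total_variation_upper) auto
      qed auto
      finally show ?thesis .
    qed
    then show "total_variation M V (\<Union>i. A i) \<le> (\<Sum>i. total_variation M V (A i))"
      unfolding total_variation_def[of M V "\<Union>i. A i"] by (intro SUP_least)
  qed
qed

section \<open>The Jordan decomposition\<close>

lemma total_variation_uminus: "total_variation M (\<lambda>A. - V A) = total_variation M V"
  by (simp add: total_variation_def fun_eq_iff)

text \<open>Lets facts about the negative part be inherited from the positive part of the negated
  measure.\<close>

lemma negative_part_eq: "negative_part M V = positive_part M (\<lambda>A. - V A)"
  by (simp add: positive_part_def negative_part_def total_variation_uminus)

lemma signed_measure_uminus: "signed_measure M V \<Longrightarrow> signed_measure M (\<lambda>A. - V A)"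
  unfolding signed_measure_def by (auto intro: sums_minus)

lemma sets_positive_part [simp, measurable_cong]: "sets (positive_part M V) = sets M"
  by (simp add: positive_part_def sets.space_closed sets.sigma_sets_eq)

lemma space_positive_part [simp]: "space (positive_part M V) = space M"
  by (simp add: positive_part_def sets.space_closed space_measure_of)

lemma sets_negative_part [simp, measurable_cong]: "sets (negative_part M V) = sets M"
  by (simp add: negative_part_eq)

lemma space_negative_part [simp]: "space (negative_part M V) = space M"
  by (simp add: negative_part_eq)

lemma total_variation_finite:
  assumes "signed_measure M V" "total_variation M V (space M) < \<infinity>" "A \<in> sets M"
  shows "total_variation M V A < \<infinity>"
proof -
  have "total_variation M V A \<le> total_variation M V (space M)"
  proof (rule total_variation_mono)
    show "V {} = 0" using assms(1) by (rule signed_measure_empty)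
  qed (use assms sets.sets_into_space in auto)
  then show ?thesis using assms(2) by (rule order.strict_trans1)
qed

lemma abs_le_enn2real_total_variation:
  assumes "signed_measure M V" "total_variation M V (space M) < \<infinity>" "A \<in> sets M"
  shows "\<bar>V A\<bar> \<le> enn2real (total_variation M V A)"
proof -
  have "V {} = 0" using assms(1) by (rule signed_measure_empty)
  then have "ennreal \<bar>V A\<bar> \<le> total_variation M V A"
    using assms(3) by (intro abs_le_total_variation) auto
  then have "enn2real (ennreal \<bar>V A\<bar>) \<le> enn2real (total_variation M V A)"
    using total_variation_finite[OF assms] by (intro enn2real_mono) auto
  then show ?thesis by simp
qed

text \<open>\<open>measure_of\<close> returns the zero measure unless its set function is a measure,
  so this has to be verified. Finite variation makes the half sum real-valued, and \<bar>V A\<bar>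
  \<le> \<bar>V\<bar>(A) makes it nonnegative.\<close>

lemma emeasure_positive_part:
  assumes V: "signed_measure M V" "total_variation M V (space M) < \<infinity>" and A: "A \<in> sets M"
  shows "emeasure (positive_part M V) A = ennreal ((enn2real (total_variation M V A) + V A) / 2)"
  unfolding positive_part_def
proof (rule emeasure_measure_of_sigma[where
      \<mu> = "\<lambda>A. ennreal ((enn2real (total_variation M V A) + V A) / 2)"])
  define \<tau> where "\<tau> = (\<lambda>A. enn2real (total_variation M V A))"
  have V0: "V {} = 0" using V(1) by (rule signed_measure_empty)
  have nonneg: "0 \<le> (\<tau> A + V A) / 2" if "A \<in> sets M" for A
    using abs_le_enn2real_total_variation[OF V that] by (simp add: \<tau>_def)
  \<comment> \<open>Superadditivity gives t + t \<le> t for the value t at the empty set, and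
    finiteness then forces t = 0.\<close>
  have TV0: "total_variation M V {} = 0"
  proof -
    have "total_variation M V {} + total_variation M V {} \<le> total_variation M V {}"
      using total_variation_superadd[of "{}" M "{}" V] V0 by simp
    moreover have "total_variation M V {} < \<infinity>"
      using total_variation_finite[OF V, of "{}"] by simp
    ultimately show ?thesis
      by (metis ennreal_add_left_cancel_le add.right_neutral infinity_ennreal_def le_zero_eq less_irrefl)
  qed
  show "sigma_algebra (space M) (sets M)" ..
  show "positive (sets M) (\<lambda>A. ennreal ((enn2real (total_variation M V A) + V A) / 2))"
    by (simp add: positive_def V0 TV0)
  have "countably_additive (sets M) (\<lambda>A. ennreal ((\<tau> A + V A) / 2))"
  proof (rule countably_additiveI)
    fix A :: "nat \<Rightarrow> 'a set"
    assume A: "range A \<subseteq> sets M" "disjoint_family A" and UA: "(\<Union>i. A i) \<in> sets M"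
    have mA: "A i \<in> sets M" for i using A by auto
    have real: "ennreal (\<tau> B) = total_variation M V B" if "B \<in> sets M" for B
      using total_variation_finite[OF V that] by (simp add: \<tau>_def)
    have "(\<Sum>i. total_variation M V (A i)) = total_variation M V (\<Union>i. A i)"
      using total_variation_countably_additive[OF V(1)] A UA by (simp add: countably_additive_def)
    then have "(\<lambda>i. total_variation M V (A i)) sums total_variation M V (\<Union>i. A i)"
      by (metis summableI summable_sums)
    then have "(\<lambda>i. ennreal (\<tau> (A i))) sums ennreal (\<tau> (\<Union>i. A i))"
      using real mA UA by simp
    then have "(\<lambda>i. \<tau> (A i)) sums \<tau> (\<Union>i. A i)"
      by (subst (asm) sums_ennreal) (auto simp: \<tau>_def)
    \<comment> \<open>V takes both signs, so the two series are added in the reals; nonnegativity of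
      the half sums brings the result back to \<open>ennreal\<close>.\<close>
    from sums_divide[OF sums_add[OF this signed_measure_sums[OF V(1) A]], of 2]
    have "(\<lambda>i. (\<tau> (A i) + V (A i)) / 2) sums ((\<tau> (\<Union>i. A i) + V (\<Union>i. A i)) / 2)" .
    then have "(\<lambda>i. ennreal ((\<tau> (A i) + V (A i)) / 2)) sums ennreal ((\<tau> (\<Union>i. A i) + V (\<Union>i. A i)) / 2)"
      using nonneg[OF mA] nonneg[OF UA] by (subst sums_ennreal)
    then show "(\<Sum>i. ennreal ((\<tau> (A i) + V (A i)) / 2)) = ennreal ((\<tau> (\<Union>i. A i) + V (\<Union>i. A i)) / 2)"
      by (rule sums_unique[symmetric])
  qed
  then show "countably_additive (sets M) (\<lambda>A. ennreal ((enn2real (total_variation M V A) + V A) / 2))"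
    by (simp add: \<tau>_def)
qed fact

lemma finite_measure_positive_part:
  assumes "signed_measure M V" "total_variation M V (space M) < \<infinity>"
  shows "finite_measure (positive_part M V)"
  by (rule finite_measureI) (simp add: emeasure_positive_part[OF assms])

lemma finite_measure_negative_part:
  assumes "signed_measure M V" "total_variation M V (space M) < \<infinity>"
  shows "finite_measure (negative_part M V)"
  unfolding negative_part_eq
  using assms by (intro finite_measure_positive_part) (simp_all add: signed_measure_uminus total_variation_uminus)

lemma measure_positive_part_le:
  assumes "signed_measure M V" "total_variation M V (space M) < \<infinity>" "A \<in> sets M"
  shows "measure (positive_part M V) A \<le> enn2real (total_variation M V A)"
  using abs_le_enn2real_total_variation[OF assms]
  by (simp add: measure_def emeasure_positive_part[OF assms])

text \<open>The negative part can only lower the integral of a nonnegative function. This is where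
  the sign of V is disposed of.\<close>

lemma signed_integral_le_positive_part:
  assumes "\<And>x. x \<in> space M \<Longrightarrow> 0 \<le> f x"
  shows "signed_integral M V f \<le> integral\<^sup>L (positive_part M V) f"
  using assms by (auto simp: signed_integral_def intro!: integral_nonneg_AE AE_I2)

text \<open>Dominated convergence under each part separately; both are finite measures, so a
  constant is an integrable majorant.\<close>

lemma signed_integral_tendsto:
  assumes V: "signed_measure M V" "total_variation M V (space M) < \<infinity>"
    and meas: "\<And>n. f n \<in> borel_measurable M" "g \<in> borel_measurable M"
    and lim: "\<And>x. x \<in> space M \<Longrightarrow> (\<lambda>n. f n x) \<longlonglongrightarrow> g x"
    and bound: "\<And>n x. x \<in> space M \<Longrightarrow> \<bar>f n x\<bar> \<le> C"
  shows "(\<lambda>n. signed_integral M V (f n)) \<longlonglongrightarrow> signed_integral M V g"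
proof -
  interpret P: finite_measure "positive_part M V" by (rule finite_measure_positive_part[OF V])
  interpret N: finite_measure "negative_part M V" by (rule finite_measure_negative_part[OF V])
  note [measurable] = meas
  have "(\<lambda>n. integral\<^sup>L (positive_part M V) (f n)) \<longlonglongrightarrow> integral\<^sup>L (positive_part M V) g"
    by (rule integral_dominated_convergence[where w = "\<lambda>_. C"]) (use lim bound in auto)
  moreover have "(\<lambda>n. integral\<^sup>L (negative_part M V) (f n)) \<longlonglongrightarrow> integral\<^sup>L (negative_part M V) g"
    by (rule integral_dominated_convergence[where w = "\<lambda>_. C"]) (use lim bound in auto)
  ultimately show ?thesis
    unfolding signed_integral_def by (rule tendsto_diff)
qed

section \<open>Finite positive measures regarded as signed measures\<close>

context
  fixes M \<mu> :: "'a measure" and V :: "'a set \<Rightarrow> real"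
  assumes fin: "finite_measure \<mu>" and sets_eq: "sets \<mu> = sets M"
    and V: "\<And>A. A \<in> sets M \<Longrightarrow> V A = measure \<mu> A"
begin

interpretation finite_measure \<mu> by (rule fin)

lemma signed_measure_of_measure: "signed_measure M V"
  unfolding signed_measure_def
proof (intro conjI allI impI)
  fix A :: "nat \<Rightarrow> 'a set" assume A: "range A \<subseteq> sets M" "disjoint_family A"
  then have "(\<lambda>i. measure \<mu> (A i)) sums measure \<mu> (\<Union>i. A i)"
    by (intro finite_measure_UNION) (auto simp: sets_eq)
  then show "(\<lambda>i. V (A i)) sums V (\<Union>i. A i)"
    using A V[of "A _"] V[OF sets.countable_UN[OF A(1)]] by (simp add: range_subsetD)
qed (simp add: V)

text \<open>For a positive measure every partition yields the same sum, and the trivial one already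
  attains the supremum.\<close>

lemma total_variation_of_measure:
  assumes E: "E \<in> sets M"
  shows "total_variation M V E = emeasure \<mu> E"
proof (rule antisym)
  show "total_variation M V E \<le> emeasure \<mu> E"
    unfolding total_variation_def
  proof (rule SUP_least)
    fix A assume A: "A \<in> partitions M E"
    then have "(\<Sum>i. ennreal \<bar>V (A i)\<bar>) = (\<Sum>i. emeasure \<mu> (A i))"
      by (intro suminf_cong) (auto simp: V emeasure_eq_measure)
    also have "\<dots> = emeasure \<mu> E"
      using A by (subst suminf_emeasure) (auto simp: sets_eq)
    finally show "(\<Sum>i. ennreal \<bar>V (A i)\<bar>) \<le> emeasure \<mu> E" by simp
  qed
  have "ennreal \<bar>V E\<bar> \<le> total_variation M V E"
    using E V by (intro abs_le_total_variation) auto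
  then show "emeasure \<mu> E \<le> total_variation M V E"
    using E by (simp add: V emeasure_eq_measure)
qed

text \<open>Total variation and V coincide, so the positive part is \<mu> and the negative part is
  the zero measure.\<close>

lemma signed_integral_of_measure: "signed_integral M V f = integral\<^sup>L \<mu> f"
proof -
  have tv: "total_variation M V (space M) < \<infinity>"
    by (subst total_variation_of_measure) (auto simp: less_top[symmetric])
  note sm = signed_measure_of_measure
  have "emeasure (positive_part M V) A = emeasure \<mu> A" if "A \<in> sets M" for A
    using that by (simp add: emeasure_positive_part[OF sm tv] total_variation_of_measure V emeasure_eq_measure)
  then have P: "positive_part M V = \<mu>"
    by (intro measure_eqI) (auto simp: sets_eq)
  have "emeasure (negative_part M V) (space M) = 0"
    unfolding negative_part_eq
    using tv signed_measure_uminus[OF sm]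
    by (subst emeasure_positive_part)
      (auto simp: total_variation_uminus total_variation_of_measure V emeasure_eq_measure)
  then have "AE x in negative_part M V. False"
    by (intro AE_I[of _ _ "space M"]) auto
  then have "integral\<^sup>L (negative_part M V) f = 0"
    by (intro integral_eq_zero_AE) (auto elim: eventually_mono)
  then show ?thesis by (simp add: signed_integral_def P)
qed

end

section \<open>Integrable functions regarded as signed measures on the interval\<close>

lemma sets_borel_interval: "A \<in> sets (borel_interval b) \<longleftrightarrow> A \<in> sets borel \<and> A \<subseteq> {-b<..<b}"
  by (auto simp: sets_restrict_space_iff)

lemma space_borel_interval [simp]: "space (borel_interval b) = {-b<..<b}"
  by (simp add: space_restrict_space)

text \<open>Every finite variation sum is dominated by the L^1 norm of f; this one bound gives both
  the convergence of the series and the finiteness of the total variation.\<close>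

lemma density_signed_measure_finite:
  assumes f: "f \<in> L1 b"
  shows "density_signed_measure f \<in> finite_signed_measures b"
proof -
  let ?V = "density_signed_measure f" and ?\<Omega> = "{-b<..<b}"
  have fi: "set_integrable lebesgue ?\<Omega> f" using f by (simp add: L1_def)
  have int: "set_integrable lebesgue A f" "set_integrable lebesgue A (\<lambda>x. \<bar>f x\<bar>)"
    and leb: "A \<in> sets lebesgue" if "A \<in> sets (borel_interval b)" for A
  proof -
    show "A \<in> sets lebesgue" using that by (auto simp: sets_borel_interval)
    then show "set_integrable lebesgue A f" "set_integrable lebesgue A (\<lambda>x. \<bar>f x\<bar>)"
      using that set_integrable_subset[OF fi, of A] set_integrable_abs[of lebesgue A f]
      by (auto simp: sets_borel_interval)
  qed
  have bound: "(\<Sum>i<n. \<bar>?V (A i)\<bar>) \<le> (LINT x:?\<Omega>|lebesgue. \<bar>f x\<bar>)"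
    if A: "range A \<subseteq> sets (borel_interval b)" "disjoint_family A" for A :: "nat \<Rightarrow> real set" and n
  proof -
    have mA: "A i \<in> sets (borel_interval b)" for i using A by auto
    have "(\<Sum>i<n. \<bar>?V (A i)\<bar>) \<le> (\<Sum>i<n. LINT x:A i|lebesgue. \<bar>f x\<bar>)"
    proof (rule sum_mono)
      fix i
      show "\<bar>?V (A i)\<bar> \<le> (LINT x:A i|lebesgue. \<bar>f x\<bar>)"
        unfolding density_signed_measure_def set_lebesgue_integral_def
        by (rule order_trans[OF integral_abs_bound]) (simp add: abs_mult)
    qed
    also have "\<dots> = (LINT x:(\<Union>i<n. A i)|lebesgue. \<bar>f x\<bar>)"
      using A int(2)[OF mA] leb[OF mA]
      by (intro set_integral_finite_Union[symmetric])
        (auto simp: disjoint_family_on_def)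
    also have "\<dots> \<le> (LINT x:?\<Omega>|lebesgue. \<bar>f x\<bar>)"
      unfolding set_lebesgue_integral_def
    proof (rule integral_mono)
      have U: "(\<Union>i<n. A i) \<in> sets (borel_interval b)" using mA by (intro sets.finite_UN) auto
      show "integrable lebesgue (\<lambda>x. indicat_real (\<Union>i<n. A i) x *\<^sub>R \<bar>f x\<bar>)"
        using int(2)[OF U] by (simp add: set_integrable_def)
      show "integrable lebesgue (\<lambda>x. indicat_real ?\<Omega> x *\<^sub>R \<bar>f x\<bar>)"
        using int(2)[of ?\<Omega>] by (simp add: set_integrable_def sets_borel_interval)
      show "indicat_real (\<Union>i<n. A i) x *\<^sub>R \<bar>f x\<bar> \<le> indicat_real ?\<Omega> x *\<^sub>R \<bar>f x\<bar>" for x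
        using U unfolding sets_borel_interval by (auto split: split_indicator)
    qed
    finally show ?thesis .
  qed
  have sm: "signed_measure (borel_interval b) ?V"
    unfolding signed_measure_def
  proof (intro conjI allI impI)
    fix A :: "nat \<Rightarrow> real set" assume A: "range A \<subseteq> sets (borel_interval b)" "disjoint_family A"
    have "summable (\<lambda>i. \<bar>?V (A i)\<bar>)"
      by (rule summableI_nonneg_bounded[OF _ bound[OF A]]) simp
    then have "summable (\<lambda>i. ?V (A i))" by (rule summable_rabs_cancel)
    moreover have "?V (\<Union>i. A i) = (\<Sum>i. ?V (A i))"
      unfolding density_signed_measure_def
      using A leb by (intro lebesgue_integral_countable_add int sets.countable_UN)
        (auto simp: disjoint_family_on_def)
    ultimately show "(\<lambda>i. ?V (A i)) sums ?V (\<Union>i. A i)"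
      by (simp add: sums_iff)
  qed (simp add: density_signed_measure_def set_lebesgue_integral_def)
  have "total_variation (borel_interval b) ?V ?\<Omega> \<le> ennreal (LINT x:?\<Omega>|lebesgue. \<bar>f x\<bar>)"
    unfolding total_variation_def
  proof (rule SUP_least)
    fix A assume A: "A \<in> partitions (borel_interval b) ?\<Omega>"
    have "(\<Sum>i<n. ennreal \<bar>?V (A i)\<bar>) \<le> ennreal (LINT x:?\<Omega>|lebesgue. \<bar>f x\<bar>)" for n
      using bound[of A n] A by (subst sum_ennreal) (auto intro!: ennreal_leI)
    then show "(\<Sum>i. ennreal \<bar>?V (A i)\<bar>) \<le> ennreal (LINT x:?\<Omega>|lebesgue. \<bar>f x\<bar>)"
      by (intro suminf_le_const) auto
  qed
  then have "total_variation (borel_interval b) ?V ?\<Omega> < \<infinity>"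
    by (rule order.strict_trans1) simp
  with sm show ?thesis by (simp add: finite_signed_measures_def)
qed

text \<open>Every subset of a point is Lebesgue null, so all variation sums vanish. The absence of
  atoms is what separates f dx from the extremal point mass.\<close>

lemma density_total_variation_singleton:
  "total_variation M (density_signed_measure f) {x} = 0"
proof -
  have "density_signed_measure f A = 0" if "A \<subseteq> {x}" for A
  proof -
    have "negligible A" using negligible_subset[OF _ that] by simp
    then have "A \<in> null_sets lebesgue" by (simp add: negligible_iff_null_sets)
    then show ?thesis
      unfolding density_signed_measure_def set_lebesgue_integral_def
      by (intro integral_eq_zero_AE) (auto dest!: AE_not_in elim: eventually_mono simp: indicator_def)
  qed
  then have "(\<Sum>i. ennreal \<bar>density_signed_measure f (A i)\<bar>) = 0" if "A \<in> partitions M {x}" for A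
  proof -
    have "A i \<subseteq> {x}" for i using that by auto
    then show ?thesis using \<open>\<And>A. A \<subseteq> {x} \<Longrightarrow> density_signed_measure f A = 0\<close> by simp
  qed
  then have "total_variation M (density_signed_measure f) {x} \<le> 0"
    unfolding total_variation_def by (intro SUP_least) (simp only: order_refl)
  then show ?thesis by simp
qed

section \<open>Smooth functions\<close>

text \<open>All derivatives of \<open>exp (- 1 / x)\<close> are linear combinations of these functions.\<close>

definition flat :: "nat \<Rightarrow> real \<Rightarrow> real" where
  "flat k x = (if x > 0 then exp (- 1 / x) / x ^ k else 0)"

text \<open>A generated class rather than all infinitely differentiable functions: membership
  follows from closure rules, and one induction handles all derivatives. The rule
  \<open>primitive\<close> admits antiderivatives known only through their derivative.\<close>

inductive_set smooth :: "(real \<Rightarrow> real) set" where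
  const: "(\<lambda>_. c) \<in> smooth"
| flat: "flat k \<in> smooth"
| primitive: "(\<And>x. (f has_real_derivative f' x) (at x)) \<Longrightarrow> f' \<in> smooth \<Longrightarrow> f \<in> smooth"
| add: "f \<in> smooth \<Longrightarrow> g \<in> smooth \<Longrightarrow> (\<lambda>x. f x + g x) \<in> smooth"
| mult: "f \<in> smooth \<Longrightarrow> g \<in> smooth \<Longrightarrow> (\<lambda>x. f x * g x) \<in> smooth"
| inverse: "f \<in> smooth \<Longrightarrow> (\<And>x. f x \<noteq> 0) \<Longrightarrow> (\<lambda>x. inverse (f x)) \<in> smooth"
| compose: "f \<in> smooth \<Longrightarrow> g \<in> smooth \<Longrightarrow> (\<lambda>x. f (g x)) \<in> smooth"

lemma smooth_ident: "(\<lambda>x. x) \<in> smooth"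
  by (rule smooth.primitive[where f' = "\<lambda>_. 1"]) (auto intro: smooth.const)

lemma smooth_cmult: "f \<in> smooth \<Longrightarrow> (\<lambda>x. c * f x) \<in> smooth"
  using smooth.mult[OF smooth.const] .

lemma smooth_minus: "f \<in> smooth \<Longrightarrow> (\<lambda>x. - f x) \<in> smooth"
  using smooth_cmult[of f "- 1"] by simp

lemma smooth_diff: "f \<in> smooth \<Longrightarrow> g \<in> smooth \<Longrightarrow> (\<lambda>x. f x - g x) \<in> smooth"
  using smooth.add[OF _ smooth_cmult, of f g "-1"] by simp

lemma smooth_affine: "f \<in> smooth \<Longrightarrow> (\<lambda>x. f (c * x + d)) \<in> smooth"
  using smooth.compose[OF _ smooth.add[OF smooth_cmult[OF smooth_ident] smooth.const], of f c d] .

text \<open>The substitution y = 1 / x turns the right-hand limit into that of y^k / exp y at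
  infinity.\<close>

lemma flat_tendsto_0: "(flat k \<longlongrightarrow> 0) (at 0)"
proof (rule filterlim_split_at)
  have "\<forall>\<^sub>F x in at_left 0. flat k x = 0"
    by (auto simp: flat_def eventually_at_left_field intro!: exI[of _ "-1"])
  then show "(flat k \<longlongrightarrow> 0) (at_left 0)"
    by (rule tendsto_eventually)
  have "((\<lambda>y::real. y ^ k / exp y) \<longlongrightarrow> 0) at_top"
    by (rule tendsto_power_div_exp_0)
  moreover have "\<forall>\<^sub>F y in at_top. y ^ k / exp y = flat k (inverse y)"
    using eventually_gt_at_top[of 0]
    by eventually_elim (simp add: flat_def exp_minus field_simps)
  ultimately have "((\<lambda>y. flat k (inverse y)) \<longlongrightarrow> 0) at_top"
    by (rule Lim_transform_eventually)
  then show "(flat k \<longlongrightarrow> 0) (at_right 0)"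
    by (simp add: filterlim_at_right_to_top)
qed

text \<open>Away from the origin the usual rules apply on a neighbourhood. At the origin the
  difference quotient of \<open>flat k\<close> is \<open>flat (Suc k)\<close>, whose limit is known
  to be 0.\<close>

lemma flat_has_derivative:
  "(flat k has_real_derivative flat (k + 2) x - real k * flat (k + 1) x) (at x)"
proof -
  consider "x > 0" | "x < 0" | "x = 0" by linarith
  then show ?thesis
  proof cases
    case 1
    have "((\<lambda>x. exp (- 1 / x) / x ^ k) has_real_derivative
        (exp (- 1 / x) * (1 / x\<^sup>2) * x ^ k - exp (- 1 / x) * (real k * x ^ (k - 1))) / (x ^ k * x ^ k)) (at x)"
      using 1 by (auto intro!: derivative_eq_intros simp: power2_eq_square)
    \<comment> \<open>For k = 0 the truncated exponent \<open>k - 1\<close> is harmless because of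
      the factor \<open>real k\<close>.\<close>
    also have "real k * x ^ (k - 1) = real k * x ^ k / x"
      using 1 by (cases k) auto
    also have "(exp (- 1 / x) * (1 / x\<^sup>2) * x ^ k - exp (- 1 / x) * (real k * x ^ k / x)) / (x ^ k * x ^ k)
        = flat (k + 2) x - real k * flat (k + 1) x"
      using 1 by (simp add: flat_def field_simps power2_eq_square)
    finally have "((\<lambda>x. exp (- 1 / x) / x ^ k) has_real_derivative flat (k + 2) x - real k * flat (k + 1) x) (at x)" .
    moreover have "\<forall>\<^sub>F y in nhds x. exp (- 1 / y) / y ^ k = flat k y"
      using 1 by (auto simp: flat_def eventually_nhds intro!: exI[of _ "{0<..}"])
    ultimately show ?thesis by (subst (asm) DERIV_cong_ev) auto
  next
    case 2
    have "\<forall>\<^sub>F y in nhds x. 0 = flat k y"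
      using 2 by (auto simp: flat_def eventually_nhds intro!: exI[of _ "{..<0}"])
    moreover have "((\<lambda>_. 0) has_real_derivative flat (k + 2) x - real k * flat (k + 1) x) (at x)"
      using 2 by (simp add: flat_def)
    ultimately show ?thesis by (subst (asm) DERIV_cong_ev) auto
  next
    case 3
    have "((\<lambda>h. (flat k (0 + h) - flat k 0) / h) \<longlongrightarrow> 0) (at 0)"
    proof (rule Lim_transform_eventually[OF flat_tendsto_0[of "Suc k"]])
      show "\<forall>\<^sub>F h in at 0. flat (Suc k) h = (flat k (0 + h) - flat k 0) / h"
        by (simp add: flat_def eventually_at_filter)
    qed
    with 3 show ?thesis by (simp add: DERIV_def flat_def)
  qed
qed

text \<open>Each closure rule has a matching differentiation rule whose result is again built from
  members. Keeping the derivative inside the class is what permits iteration.\<close>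

lemma smooth_has_derivative:
  "f \<in> smooth \<Longrightarrow> \<exists>f'\<in>smooth. \<forall>x. (f has_real_derivative f' x) (at x)"
proof (induction rule: smooth.induct)
  case (const c)
  show ?case by (rule bexI[of _ "\<lambda>_. 0"]) (auto intro: smooth.const)
next
  case (flat k)
  have "(\<lambda>x. flat (k + 2) x - real k * flat (k + 1) x) \<in> smooth"
    by (rule smooth_diff[OF smooth.flat smooth_cmult[OF smooth.flat]])
  then show ?case by (rule bexI[rotated]) (intro allI flat_has_derivative)
next
  case (primitive f f')
  then show ?case by blast
next
  case (add f g)
  then obtain f' g' where "f' \<in> smooth" "g' \<in> smooth"
    "\<And>x. (f has_real_derivative f' x) (at x)" "\<And>x. (g has_real_derivative g' x) (at x)" by blast
  then show ?case
    by (intro bexI[of _ "\<lambda>x. f' x + g' x"]) (auto intro: smooth.add DERIV_add)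
next
  case (mult f g)
  then obtain f' g' where "f' \<in> smooth" "g' \<in> smooth"
    "\<And>x. (f has_real_derivative f' x) (at x)" "\<And>x. (g has_real_derivative g' x) (at x)" by blast
  with mult.hyps show ?case
    by (intro bexI[of _ "\<lambda>x. f' x * g x + g' x * f x"]) (auto intro: smooth.add smooth.mult DERIV_mult)
next
  case (inverse f)
  then obtain f' where "f' \<in> smooth" "\<And>x. (f has_real_derivative f' x) (at x)" by blast
  moreover have inv: "(\<lambda>x. inverse (f x)) \<in> smooth"
    using inverse.hyps by (rule smooth.inverse)
  ultimately have "(\<lambda>x. - (inverse (f x) * f' x * inverse (f x))) \<in> smooth"
    by (intro smooth_minus smooth.mult)
  moreover have "((\<lambda>x. inverse (f x)) has_real_derivative - (inverse (f x) * f' x * inverse (f x))) (at x)" for x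
    using \<open>\<And>x. (f has_real_derivative f' x) (at x)\<close> inverse.hyps(2) by (rule DERIV_inverse')
  ultimately show ?case by (intro bexI[where x = "\<lambda>x. - (inverse (f x) * f' x * inverse (f x))"] allI)
next
  case (compose f g)
  then obtain f' g' where "f' \<in> smooth" "g' \<in> smooth"
    "\<And>x. (f has_real_derivative f' x) (at x)" "\<And>x. (g has_real_derivative g' x) (at x)" by blast
  with compose.hyps show ?case
    by (intro bexI[of _ "\<lambda>x. f' (g x) * g' x"]) (auto intro: smooth.mult smooth.compose DERIV_chain2)
qed

lemma smooth_differentiable: "f \<in> smooth \<Longrightarrow> (deriv ^^ n) f differentiable (at x)"
proof (induction n arbitrary: f)
  case 0
  then show ?case using smooth_has_derivative real_differentiable_def by fastforce
next
  case (Suc n)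
  obtain f' where f': "f' \<in> smooth" "\<And>x. (f has_real_derivative f' x) (at x)"
    using smooth_has_derivative[OF Suc.prems] by blast
  then have "deriv f = f'" by (auto intro: DERIV_imp_deriv)
  then show ?case using Suc.IH[OF f'(1)] by (simp add: funpow_Suc_right del: funpow.simps)
qed

lemma smooth_continuous_on: "f \<in> smooth \<Longrightarrow> continuous_on A f"
  using smooth_has_derivative[of f]
  by (auto intro: DERIV_continuous_on has_field_derivative_at_within)

text \<open>A mollified sign function at scale \<epsilon>, bundled with its derivative, a
  nonnegative bump of total mass 2.\<close>

definition smooth_sgn :: "real \<Rightarrow> (real \<Rightarrow> real) \<Rightarrow> (real \<Rightarrow> real) \<Rightarrow> bool" where
  "smooth_sgn \<epsilon> T T' \<longleftrightarrow> T \<in> smooth \<and> T' \<in> smooth \<and> (\<forall>x. (T has_real_derivative T' x) (at x)) \<and>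
     (\<forall>x. 0 \<le> T' x) \<and> (\<forall>x. \<epsilon> < \<bar>x\<bar> \<longrightarrow> T' x = 0) \<and> (\<forall>x. \<bar>T x\<bar> \<le> 1) \<and> (\<forall>x. T (- x) = - T x) \<and>
     (\<forall>x\<ge>\<epsilon>. T x = 1) \<and> (\<forall>x\<le>-\<epsilon>. T x = - 1)"

lemma smooth_sgnD:
  assumes "smooth_sgn \<epsilon> T T'"
  shows "T \<in> smooth" "T' \<in> smooth" "(T has_real_derivative T' x) (at x)" "0 \<le> T' x"
    "\<epsilon> < \<bar>x\<bar> \<Longrightarrow> T' x = 0" "\<bar>T x\<bar> \<le> 1" "T (- x) = - T x" "\<epsilon> \<le> x \<Longrightarrow> T x = 1" "x \<le> - \<epsilon> \<Longrightarrow> T x = - 1"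
  using assms by (simp_all add: smooth_sgn_def)

text \<open>The normalised odd part of a smooth one-sided step p. The denominator never vanishes,
  because x or - x lies to the right of - \<epsilon>.\<close>

lemma smooth_sgn_exists:
  assumes "\<epsilon> > 0"
  shows "\<exists>T T'. smooth_sgn \<epsilon> T T'"
proof -
  \<comment> \<open>This is exp (- 1 / t) at t = x / \<epsilon> + 1, extended by 0 to t \<le> 0, so
    it vanishes exactly for x \<le> - \<epsilon>.\<close>
  define p where "p = (\<lambda>x. flat 0 (x / \<epsilon> + 1))"
  define T where "T = (\<lambda>x. (p x - p (- x)) * inverse (p x + p (- x)))"
  have p_nonneg: "0 \<le> p x" for x by (simp add: p_def flat_def)
  have p_mono: "p x \<le> p y" if "x \<le> y" for x y
    using that assms by (auto simp: p_def flat_def divide_simps intro: add_pos_pos)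
  have p_pos: "0 < p x" if "- \<epsilon> < x" for x
    using that assms by (auto simp: p_def flat_def field_simps)
  have p_zero: "p x = 0" if "x \<le> - \<epsilon>" for x
    using that assms by (auto simp: p_def flat_def field_simps)
  have pos: "0 < p x + p (- x)" for x
    using p_pos[of x] p_pos[of "- x"] p_nonneg[of x] p_nonneg[of "- x"] assms by (cases "x \<ge> 0") auto
  have "p \<in> smooth"
    using smooth_affine[OF smooth.flat, of 0 "1 / \<epsilon>" 1] by (simp add: p_def)
  moreover have "(\<lambda>x. p (- x)) \<in> smooth"
    using smooth_affine[OF calculation, of "- 1" 0] by simp
  ultimately have T: "T \<in> smooth"
    unfolding T_def using pos
    by (intro smooth.mult smooth_diff smooth.inverse smooth.add) (auto simp: less_imp_neq[THEN not_sym])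
  then obtain T' where T': "T' \<in> smooth" "\<And>x. (T has_real_derivative T' x) (at x)"
    using smooth_has_derivative by blast
  \<comment> \<open>After cross multiplication the claim is twice the inequality p x p (- y) \<le> p
    y p (- x), a product of two monotonicity statements.\<close>
  have T_mono: "T x \<le> T y" if "x \<le> y" for x y
  proof -
    have "p x * p (- y) \<le> p y * p (- x)"
      using p_mono[OF that] p_mono[of "- y" "- x"] that p_nonneg by (intro mult_mono) auto
    then have "(p x - p (- x)) * (p y + p (- y)) \<le> (p y - p (- y)) * (p x + p (- x))"
      by (simp add: algebra_simps)
    then show ?thesis
      using pos[of x] pos[of y] by (simp add: T_def divide_inverse[symmetric] field_simps)
  qed
  have T1: "T x = 1" if "\<epsilon> \<le> x" for x
    using p_zero[of "- x"] p_pos[of x] that assms by (simp add: T_def)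
  have odd: "T (- x) = - T x" for x
    by (simp add: T_def add.commute minus_mult_left)
  have T2: "T x = - 1" if "x \<le> - \<epsilon>" for x
    using T1[of "- x"] odd[of x] that by simp
  \<comment> \<open>Monotonicity traps T x between its values in the two regions where T is
    constant.\<close>
  have "\<bar>T x\<bar> \<le> 1" for x
    using T_mono[of x "max x \<epsilon>"] T_mono[of "min x (- \<epsilon>)" x] T1[of "max x \<epsilon>"] T2[of "min x (- \<epsilon>)"]
    by auto
  moreover have "0 \<le> T' x" for x
    using T'(2) T_mono by (intro mono_on_imp_deriv_nonneg[of UNIV T]) (auto simp: mono_on_def)
  moreover have "T' x = 0" if "\<epsilon> < \<bar>x\<bar>" for x
  proof -
    have "\<forall>\<^sub>F y in nhds x. T y = (if x > 0 then 1 else - 1)"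
    proof (cases "x > 0")
      case True
      then show ?thesis using that T1
        by (auto simp: eventually_nhds intro!: exI[of _ "{\<epsilon><..}"])
    next
      case False
      then show ?thesis using that T2
        by (auto simp: eventually_nhds intro!: exI[of _ "{..<-\<epsilon>}"])
    qed
    then have "(T has_real_derivative 0) (at x)"
      by (subst DERIV_cong_ev) auto
    with T'(2) show ?thesis by (rule DERIV_unique)
  qed
  ultimately have "smooth_sgn \<epsilon> T T'"
    using T T' T1 T2 odd by (simp add: smooth_sgn_def)
  then show ?thesis by blast
qed

section \<open>Test functions\<close>

text \<open>The margin r < b keeps the closure of the support inside the open interval.\<close>

lemma smooth_test_function:
  assumes "\<psi> \<in> smooth" "r < b" "\<And>x. r < \<bar>x\<bar> \<Longrightarrow> \<psi> x = 0"
  shows "\<psi> \<in> test_functions b"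
proof -
  have "{x. \<psi> x \<noteq> 0} \<subseteq> {-r..r}"
  proof
    fix x assume "x \<in> {x. \<psi> x \<noteq> 0}"
    then have "\<bar>x\<bar> \<le> r" using assms(3)[of x] by force
    then show "x \<in> {-r..r}" by auto
  qed
  then have "closure {x. \<psi> x \<noteq> 0} \<subseteq> {-r..r}" by (intro closure_minimal) auto
  also have "\<dots> \<subseteq> {-b<..<b}" using assms(2) by auto
  finally show ?thesis using smooth_differentiable[OF assms(1)] by (simp add: test_functions_def)
qed

context
  fixes \<psi> :: "real \<Rightarrow> real" and b :: real
  assumes \<psi>: "\<psi> \<in> test_functions b"
begin

lemma test_function_DERIV: "(\<psi> has_real_derivative deriv \<psi> x) (at x)"
proof -
  have "(deriv ^^ 0) \<psi> differentiable (at x)"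
    using \<psi> unfolding test_functions_def by blast
  then show ?thesis by (simp add: DERIV_deriv_iff_real_differentiable)
qed

lemma test_function_continuous_on: "continuous_on A \<psi>"
  using test_function_DERIV by (meson DERIV_isCont continuous_at_imp_continuous_on)

lemma test_function_eq_0: "b \<le> \<bar>x\<bar> \<Longrightarrow> \<psi> x = 0"
proof (rule ccontr)
  assume "b \<le> \<bar>x\<bar>" "\<psi> x \<noteq> 0"
  then have "x \<in> closure {x. \<psi> x \<noteq> 0}" by (simp add: subsetD[OF closure_subset])
  then have "x \<in> {-b<..<b}" using \<psi> unfolding test_functions_def by blast
  then show False using \<open>b \<le> \<bar>x\<bar>\<close> by auto
qed

text \<open>Supports do not grow: outside its closed support \<psi> vanishes on a neighbourhood,
  hence so does its derivative.\<close>

lemma deriv_test_function: "deriv \<psi> \<in> test_functions b"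
proof -
  have "(deriv ^^ n) (deriv \<psi>) differentiable (at x)" for n x
  proof -
    have "(deriv ^^ Suc n) \<psi> differentiable (at x)"
      using \<psi> unfolding test_functions_def by blast
    then show ?thesis by (simp add: funpow_Suc_right del: funpow.simps)
  qed
  moreover have "{x. deriv \<psi> x \<noteq> 0} \<subseteq> closure {x. \<psi> x \<noteq> 0}"
  proof (rule subsetI, rule ccontr)
    fix x assume x: "x \<in> {x. deriv \<psi> x \<noteq> 0}" "x \<notin> closure {x. \<psi> x \<noteq> 0}"
    then have "\<forall>\<^sub>F y in nhds x. \<psi> y = 0"
      using closure_subset[of "{x. \<psi> x \<noteq> 0}"]
      by (auto simp: eventually_nhds intro!: exI[of _ "- closure {x. \<psi> x \<noteq> 0}"])
    then have "(\<psi> has_real_derivative 0) (at x)" by (subst DERIV_cong_ev) auto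
    then have "deriv \<psi> x = 0" by (rule DERIV_imp_deriv)
    with x show False by simp
  qed
  then have "closure {x. deriv \<psi> x \<noteq> 0} \<subseteq> closure {x. \<psi> x \<noteq> 0}" by (intro closure_minimal) auto
  ultimately show ?thesis using \<psi> by (auto simp: test_functions_def)
qed

end

section \<open>Square integrable functions on an interval\<close>

text \<open>The set integrals of the definitions are rewritten as integrals over this finite measure
  space, where the general integration theorems apply directly.\<close>

abbreviation leb_interval :: "real \<Rightarrow> real measure" where
  "leb_interval b \<equiv> restrict_space lebesgue {-b<..<b}"

lemma space_leb_interval [simp]: "space (leb_interval b) = {-b<..<b}"
  by (simp add: space_restrict_space)

lemma LINT_leb_interval: "(LINT x:{-b<..<b}|lebesgue. f x) = integral\<^sup>L (leb_interval b) f"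
  for f :: "real \<Rightarrow> real"
  by (simp add: set_lebesgue_integral_def integral_restrict_space)

lemma set_integrable_leb_interval: "set_integrable lebesgue {-b<..<b} f \<longleftrightarrow> integrable (leb_interval b) f"
  for f :: "real \<Rightarrow> real"
  by (simp add: set_integrable_def integrable_restrict_space)

lemma L2_iff: "v \<in> L2 b \<longleftrightarrow>
    v \<in> borel_measurable (leb_interval b) \<and> integrable (leb_interval b) (\<lambda>x. (v x)\<^sup>2)"
  by (simp add: L2_def set_integrable_leb_interval set_borel_measurable_def
      borel_measurable_restrict_space_iff)

lemma norm_L2_eq: "norm_L2 b v = sqrt (integral\<^sup>L (leb_interval b) (\<lambda>x. (v x)\<^sup>2))"
  by (simp add: norm_L2_def LINT_leb_interval)

lemma finite_measure_leb_interval: "finite_measure (leb_interval b)"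
  by (rule finite_measureI) (cases "-b \<le> b"; simp add: emeasure_restrict_space)

lemma measure_leb_interval: "0 < b \<Longrightarrow> measure (leb_interval b) {-b<..<b} = 2 * b"
  by (simp add: measure_restrict_space)

lemma borel_measurable_leb_interval:
  "f \<in> borel_measurable borel \<Longrightarrow> f \<in> borel_measurable (leb_interval b)"
  for f :: "real \<Rightarrow> real"
  by (intro measurable_restrict_space1 measurable_completion) simp

lemma continuous_on_measurable_leb_interval:
  fixes f :: "real \<Rightarrow> real"
  assumes "continuous_on {-b<..<b} f"
  shows "f \<in> borel_measurable (leb_interval b)"
  using assms by (rule continuous_imp_measurable_on_sets_lebesgue) simp

lemma integrable_bounded_leb_interval:
  fixes f :: "real \<Rightarrow> real"
  assumes "f \<in> borel_measurable (leb_interval b)" "\<And>x. x \<in> {-b<..<b} \<Longrightarrow> \<bar>f x\<bar> \<le> C"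
  shows "integrable (leb_interval b) f"
  by (rule finite_measure.integrable_const_bound[OF finite_measure_leb_interval, of _ C])
    (use assms in \<open>auto intro!: AE_I2\<close>)

lemma bounded_in_L2:
  assumes "f \<in> borel_measurable (leb_interval b)" "\<And>x. x \<in> {-b<..<b} \<Longrightarrow> \<bar>f x\<bar> \<le> C"
  shows "f \<in> L2 b"
  unfolding L2_iff
proof
  show "integrable (leb_interval b) (\<lambda>x. (f x)\<^sup>2)"
  proof (rule integrable_bounded_leb_interval)
    show "(\<lambda>x. (f x)\<^sup>2) \<in> borel_measurable (leb_interval b)" using assms(1) by measurable
    show "\<bar>(f x)\<^sup>2\<bar> \<le> C\<^sup>2" if "x \<in> {-b<..<b}" for x
      using power_mono[OF assms(2)[OF that], of 2] by simp
  qed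
qed (rule assms(1))

lemma continuous_on_bounded_Icc:
  fixes f :: "real \<Rightarrow> real"
  assumes "continuous_on {a..b} f"
  obtains C where "\<And>x. x \<in> {a..b} \<Longrightarrow> \<bar>f x\<bar> \<le> C"
proof -
  have "bounded (f ` {a..b})"
    using assms by (intro compact_imp_bounded compact_continuous_image) auto
  then obtain C where "\<forall>y\<in>f ` {a..b}. norm y \<le> C" unfolding bounded_iff by blast
  then have "\<And>x. x \<in> {a..b} \<Longrightarrow> \<bar>f x\<bar> \<le> C" by simp
  then show ?thesis by (rule that)
qed

lemma continuous_on_L2:
  assumes "continuous_on {-b..b} f"
  shows "f \<in> L2 b"
proof -
  obtain C where "\<And>x. x \<in> {-b..b} \<Longrightarrow> \<bar>f x\<bar> \<le> C" by (rule continuous_on_bounded_Icc[OF assms]) blast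
  then show ?thesis
    using assms by (intro bounded_in_L2[of _ _ C] continuous_on_measurable_leb_interval)
      (auto intro: continuous_on_subset)
qed

lemma integrable_mult_L2:
  assumes "f \<in> L2 b" "g \<in> L2 b"
  shows "integrable (leb_interval b) (\<lambda>x. f x * g x)"
proof -
  have [measurable]: "f \<in> borel_measurable (leb_interval b)" "g \<in> borel_measurable (leb_interval b)"
    using assms by (auto simp: L2_iff)
  have "integrable (leb_interval b) (\<lambda>x. (f x)\<^sup>2 + (g x)\<^sup>2)"
    using assms by (auto simp: L2_iff)
  then show ?thesis
  proof (rule Bochner_Integration.integrable_bound)
    have "\<bar>y * z\<bar> \<le> y\<^sup>2 + z\<^sup>2" for y z :: real
    proof -
      have "2 * \<bar>y * z\<bar> \<le> y\<^sup>2 + z\<^sup>2"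
        using sum_squares_bound[of "\<bar>y\<bar>" "\<bar>z\<bar>"] by (simp add: abs_mult mult.assoc)
      then show ?thesis by linarith
    qed
    then show "AE x in leb_interval b. norm (f x * g x) \<le> norm ((f x)\<^sup>2 + (g x)\<^sup>2)"
      by (intro AE_I2) (simp add: sum_power2_ge_zero)
  qed measurable
qed

text \<open>Expansion of the square. It serves both closure under differences, at t = 1, and the
  quadratic polynomial in t behind the Cauchy-Schwarz inequality.\<close>

lemma diff_cmult_L2:
  assumes "f \<in> L2 b" "g \<in> L2 b"
  shows "(\<lambda>x. f x - t * g x) \<in> L2 b"
    and "integral\<^sup>L (leb_interval b) (\<lambda>x. (f x - t * g x)\<^sup>2) =
      integral\<^sup>L (leb_interval b) (\<lambda>x. (f x)\<^sup>2) - 2 * t * integral\<^sup>L (leb_interval b) (\<lambda>x. f x * g x)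
        + t\<^sup>2 * integral\<^sup>L (leb_interval b) (\<lambda>x. (g x)\<^sup>2)"
proof -
  have eq: "(f x - t * g x)\<^sup>2 = (f x)\<^sup>2 - 2 * t * (f x * g x) + t\<^sup>2 * (g x)\<^sup>2" for x
    by (simp add: power2_eq_square algebra_simps)
  note [simp] = integrable_mult_L2[OF assms] assms[unfolded L2_iff]
  have [measurable]: "f \<in> borel_measurable (leb_interval b)" "g \<in> borel_measurable (leb_interval b)"
    using assms by (auto simp: L2_iff)
  show "(\<lambda>x. f x - t * g x) \<in> L2 b"
    unfolding L2_iff eq by simp
  show "integral\<^sup>L (leb_interval b) (\<lambda>x. (f x - t * g x)\<^sup>2) =
      integral\<^sup>L (leb_interval b) (\<lambda>x. (f x)\<^sup>2) - 2 * t * integral\<^sup>L (leb_interval b) (\<lambda>x. f x * g x)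
        + t\<^sup>2 * integral\<^sup>L (leb_interval b) (\<lambda>x. (g x)\<^sup>2)"
    unfolding eq by simp
qed

lemma diff_L2: "f \<in> L2 b \<Longrightarrow> g \<in> L2 b \<Longrightarrow> (\<lambda>x. f x - g x) \<in> L2 b"
  using diff_cmult_L2(1)[of f b g 1] by simp

lemma Cauchy_Schwarz_L2:
  assumes "f \<in> L2 b" "g \<in> L2 b"
  shows "(integral\<^sup>L (leb_interval b) (\<lambda>x. f x * g x))\<^sup>2
    \<le> integral\<^sup>L (leb_interval b) (\<lambda>x. (f x)\<^sup>2) * integral\<^sup>L (leb_interval b) (\<lambda>x. (g x)\<^sup>2)"
    (is "?B\<^sup>2 \<le> ?A * ?C")
proof -
  have pos: "0 \<le> ?A - 2 * t * ?B + t\<^sup>2 * ?C" for t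
    unfolding diff_cmult_L2(2)[OF assms, symmetric] by simp
  have "0 \<le> ?C" by simp
  show ?thesis
  proof (cases "?C = 0")
    case True
    have "?B = 0"
    proof (rule ccontr)
      assume "?B \<noteq> 0"
      \<comment> \<open>With C = 0 the polynomial is A - 2 t B, and this t gives it the value -
        1.\<close>
      then show False using pos[of "(?A + 1) / (2 * ?B)"] True by (simp add: field_simps)
    qed
    then show ?thesis using True by simp
  next
    case False
    then have "0 < ?C" using \<open>0 \<le> ?C\<close> by linarith
    \<comment> \<open>The minimiser of the quadratic polynomial.\<close>
    then show ?thesis using pos[of "?B / ?C"] by (simp add: field_simps power2_eq_square)
  qed
qed

lemma abs_integral_mult_le:
  assumes "f \<in> L2 b" "g \<in> L2 b"
  shows "\<bar>integral\<^sup>L (leb_interval b) (\<lambda>x. f x * g x)\<bar> \<le> norm_L2 b f * norm_L2 b g"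
  using real_sqrt_le_mono[OF Cauchy_Schwarz_L2[OF assms]]
  by (simp add: norm_L2_eq real_sqrt_mult)

lemma integral_mult_tendsto:
  assumes "\<And>n. f n \<in> L2 b" "v \<in> L2 b" "g \<in> L2 b"
    and lim: "(\<lambda>n. norm_L2 b (\<lambda>x. v x - f n x)) \<longlonglongrightarrow> 0"
  shows "(\<lambda>n. integral\<^sup>L (leb_interval b) (\<lambda>x. f n x * g x)) \<longlonglongrightarrow> integral\<^sup>L (leb_interval b) (\<lambda>x. v x * g x)"
proof (rule LIM_zero_cancel, rule Lim_null_comparison)
  show "\<forall>\<^sub>F n in sequentially. norm (integral\<^sup>L (leb_interval b) (\<lambda>x. f n x * g x) - integral\<^sup>L (leb_interval b) (\<lambda>x. v x * g x))
      \<le> norm_L2 b (\<lambda>x. v x - f n x) * norm_L2 b g"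
  proof (rule always_eventually, rule allI)
    fix n
    have "integral\<^sup>L (leb_interval b) (\<lambda>x. v x * g x) - integral\<^sup>L (leb_interval b) (\<lambda>x. f n x * g x)
        = integral\<^sup>L (leb_interval b) (\<lambda>x. (v x - f n x) * g x)"
      using assms by (simp add: left_diff_distrib integrable_mult_L2)
    then show "norm (integral\<^sup>L (leb_interval b) (\<lambda>x. f n x * g x) - integral\<^sup>L (leb_interval b) (\<lambda>x. v x * g x))
        \<le> norm_L2 b (\<lambda>x. v x - f n x) * norm_L2 b g"
      using abs_integral_mult_le[OF diff_L2[OF assms(2) assms(1)[of n]] assms(3)] by simp
  qed
  show "(\<lambda>n. norm_L2 b (\<lambda>x. v x - f n x) * norm_L2 b g) \<longlonglongrightarrow> 0"
    using tendsto_mult_left_zero[OF lim] .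
qed

text \<open>The Henstock-Kurzweil theorem supplies the value, and integrability identifies it with
  the Lebesgue integral. The finite set \<open>S\<close> accommodates the jump of the kernel and the
  corner of the tent.\<close>

lemma fundamental_theorem_leb_interval:
  fixes F f :: "real \<Rightarrow> real"
  assumes "0 < b" "finite S" "continuous_on {-b..b} F"
    and "\<And>x. x \<in> {-b<..<b} - S \<Longrightarrow> (F has_real_derivative f x) (at x)"
    and "integrable (leb_interval b) f"
  shows "integral\<^sup>L (leb_interval b) f = F b - F (- b)"
proof -
  have "(f has_integral (F b - F (- b))) {-b..b}"
    using assms by (intro fundamental_theorem_of_calculus_interior_strong[of S])
      (auto simp: has_real_derivative_iff_has_vector_derivative)
  then have "(f has_integral (F b - F (- b))) {-b<..<b}"
    by (simp add: has_integral_Icc_iff_Ioo)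
  then have "integral {-b<..<b} f = F b - F (- b)" by (rule integral_unique)
  moreover have "(LINT x:{-b<..<b}|lebesgue. f x) = integral {-b<..<b} f"
    using assms(5) by (intro set_lebesgue_integral_eq_integral) (simp add: set_integrable_leb_interval)
  ultimately show ?thesis by (simp add: LINT_leb_interval)
qed

lemma test_function_L2: "\<psi> \<in> test_functions b \<Longrightarrow> \<psi> \<in> L2 b"
  by (rule continuous_on_L2[OF test_function_continuous_on])

text \<open>The boundary terms vanish through \<psi> alone. It shows that a derivative existing off
  finitely many points, if in L^2, is the weak derivative.\<close>

lemma test_function_integration_by_parts:
  assumes "0 < b" "\<psi> \<in> test_functions b" "finite S" "continuous_on {-b..b} u"
    and u: "\<And>x. x \<in> {-b<..<b} - S \<Longrightarrow> (u has_real_derivative v x) (at x)"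
    and v: "v \<in> L2 b"
  shows "integral\<^sup>L (leb_interval b) (\<lambda>x. u x * deriv \<psi> x) = - integral\<^sup>L (leb_interval b) (\<lambda>x. v x * \<psi> x)"
proof -
  have int: "integrable (leb_interval b) (\<lambda>x. u x * deriv \<psi> x)" "integrable (leb_interval b) (\<lambda>x. v x * \<psi> x)"
    by (intro integrable_mult_L2 test_function_L2[OF assms(2)] v continuous_on_L2[OF assms(4)]
        test_function_L2[OF deriv_test_function[OF assms(2)]])+
  have "integral\<^sup>L (leb_interval b) (\<lambda>x. v x * \<psi> x + u x * deriv \<psi> x) = u b * \<psi> b - u (- b) * \<psi> (- b)"
  proof (rule fundamental_theorem_leb_interval[OF assms(1,3)])
    show "continuous_on {-b..b} (\<lambda>x. u x * \<psi> x)"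
      by (intro continuous_on_mult assms(4) test_function_continuous_on[OF assms(2)])
    show "((\<lambda>x. u x * \<psi> x) has_real_derivative v x * \<psi> x + u x * deriv \<psi> x) (at x)"
      if "x \<in> {-b<..<b} - S" for x
      using DERIV_mult[OF u[OF that] test_function_DERIV[OF assms(2), of x]] by (simp add: mult.commute)
  qed (use int in auto)
  also have "\<dots> = 0" using test_function_eq_0[OF assms(2)] assms(1) by simp
  finally show ?thesis using int by simp
qed

section \<open>The representation of functions in \<open>W\<^sub>0\<^sup>1\<^sup>,\<^sup>2\<close>\<close>

text \<open>Freezing G beyond x gives a primitive of its derivative cut off at x. This is how the
  jump of the kernel and the sign in the slope of the tent are integrated.\<close>

lemma DERIV_min:
  fixes G G' :: "real \<Rightarrow> real"
  assumes "(G has_real_derivative G' t) (at t)" "t \<noteq> x"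
  shows "((\<lambda>t. G (min t x)) has_real_derivative (if t < x then G' t else 0)) (at t)"
proof (cases "t < x")
  case True
  have "\<forall>\<^sub>F s in nhds t. G s = G (min s x)"
    using True by (auto simp: eventually_nhds intro!: exI[of _ "{..<x}"])
  then have "((\<lambda>t. G (min t x)) has_real_derivative G' t) (at t)"
    using assms(1) by (subst (asm) DERIV_cong_ev) auto
  then show ?thesis using True by simp
next
  case False
  have "\<forall>\<^sub>F s in nhds t. G x = G (min s x)"
    using False assms(2) by (auto simp: eventually_nhds intro!: exI[of _ "{x<..}"])
  then have "((\<lambda>t. G (min t x)) has_real_derivative 0) (at t)"
    using DERIV_const[of "G x" "at t"] by (subst (asm) DERIV_cong_ev) auto
  then show ?thesis using False by simp
qed

text \<open>The evaluation kernel: its square norm is the Green function of \<open>- u''\<close> on the diagonal.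
  Subtracting the mean of the indicator function makes that norm minimal.\<close>

definition kernel :: "real \<Rightarrow> real \<Rightarrow> real \<Rightarrow> real" where
  "kernel b x t = (if t < x then 1 else 0) - (b + x) / (2 * b)"

lemma kernel_L2: "kernel b x \<in> L2 b"
proof (rule bounded_in_L2)
  show "kernel b x \<in> borel_measurable (leb_interval b)"
    unfolding kernel_def by (intro borel_measurable_leb_interval) measurable
  show "\<bar>kernel b x t\<bar> \<le> 1 + \<bar>(b + x) / (2 * b)\<bar>" for t
    unfolding kernel_def by (auto intro: order_trans[OF abs_triangle_ineq4])
qed

lemma integral_kernel_square:
  assumes "0 < b" "x \<in> {-b..b}"
  shows "integral\<^sup>L (leb_interval b) (\<lambda>t. (kernel b x t)\<^sup>2) = (b\<^sup>2 - x\<^sup>2) / (2 * b)"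
proof -
  define c where "c = (b + x) / (2 * b)"
  have kernel: "kernel b x t = (if t < x then 1 else 0) - c" for t
    by (simp add: kernel_def c_def)
  \<comment> \<open>The squared kernel is 1 - 2 c + c^2 to the left of x and c^2 to the right; this
    is its primitive.\<close>
  define F where "F = (\<lambda>t. (1 - 2 * c) * min t x + c\<^sup>2 * t)"
  have "integral\<^sup>L (leb_interval b) (\<lambda>t. (kernel b x t)\<^sup>2) = F b - F (- b)"
  proof (rule fundamental_theorem_leb_interval[OF assms(1), of "{x}"])
    show "continuous_on {-b..b} F" unfolding F_def by (intro continuous_intros)
    show "integrable (leb_interval b) (\<lambda>t. (kernel b x t)\<^sup>2)"
      using kernel_L2 by (simp add: L2_iff)
    fix t assume t: "t \<in> {-b<..<b} - {x}"
    have "(F has_real_derivative (1 - 2 * c) * (if t < x then 1 else 0) + c\<^sup>2 * 1) (at t)"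
      unfolding F_def
      by (intro DERIV_add DERIV_cmult DERIV_ident DERIV_min[of "\<lambda>t. t"]) (use t in auto)
    also have "(1 - 2 * c) * (if t < x then 1 else 0) + c\<^sup>2 * 1 = (kernel b x t)\<^sup>2"
      by (simp add: kernel power2_eq_square algebra_simps)
    finally show "(F has_real_derivative (kernel b x t)\<^sup>2) (at t)" .
  qed simp
  also have "\<dots> = (b\<^sup>2 - x\<^sup>2) / (2 * b)"
    using assms by (simp add: F_def c_def field_simps power2_eq_square)
  finally show ?thesis .
qed

text \<open>The indicator of (-b, x) recovers \<phi> x from its derivative. The subtracted constant
  does not matter to the pairing, since \<phi> vanishes at both ends.\<close>

lemma test_function_kernel:
  assumes "0 < b" "x \<in> {-b..b}" "\<phi> \<in> test_functions b"
  shows "\<phi> x = integral\<^sup>L (leb_interval b) (\<lambda>t. deriv \<phi> t * kernel b x t)"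
proof -
  define c where "c = (b + x) / (2 * b)"
  have kernel: "kernel b x t = (if t < x then 1 else 0) - c" for t
    by (simp add: kernel_def c_def)
  define F where "F = (\<lambda>t. \<phi> (min t x) - c * \<phi> t)"
  have "integral\<^sup>L (leb_interval b) (\<lambda>t. deriv \<phi> t * kernel b x t) = F b - F (- b)"
  proof (rule fundamental_theorem_leb_interval[OF assms(1), of "{x}"])
    show "continuous_on {-b..b} F" unfolding F_def
      by (intro continuous_intros test_function_continuous_on[OF assms(3)]
          continuous_on_compose2[OF test_function_continuous_on[OF assms(3), of UNIV]]) auto
    show "integrable (leb_interval b) (\<lambda>t. deriv \<phi> t * kernel b x t)"
      by (intro integrable_mult_L2 kernel_L2 test_function_L2 deriv_test_function assms(3))
    fix t assume t: "t \<in> {-b<..<b} - {x}"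
    have "(F has_real_derivative (if t < x then deriv \<phi> t else 0) - c * deriv \<phi> t) (at t)"
      unfolding F_def
      by (intro DERIV_diff DERIV_cmult DERIV_min test_function_DERIV[OF assms(3)]) (use t in auto)
    also have "(if t < x then deriv \<phi> t else 0) - c * deriv \<phi> t = deriv \<phi> t * kernel b x t"
      by (simp add: kernel algebra_simps)
    finally show "(F has_real_derivative deriv \<phi> t * kernel b x t) (at t)" .
  qed simp
  also have "\<dots> = \<phi> x"
    using assms test_function_eq_0[OF assms(3), of b] test_function_eq_0[OF assms(3), of "- b"]
    by (simp add: F_def)
  finally show ?thesis by simp
qed

text \<open>A bound independent of x, so that L^2 convergence of derivatives yields uniform
  convergence of the functions.\<close>

lemma norm_kernel_le:
  assumes "0 < b" "x \<in> {-b..b}"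
  shows "norm_L2 b (kernel b x) \<le> sqrt b"
proof -
  have "(b\<^sup>2 - x\<^sup>2) / (2 * b) \<le> b\<^sup>2 / b"
    using assms by (intro frac_le) auto
  also have "\<dots> = b" using assms by (simp add: power2_eq_square)
  finally show ?thesis by (simp add: norm_L2_eq integral_kernel_square[OF assms])
qed

text \<open>The test function is a smoothed indicator function of \<open>[p, q]\<close>, whose derivative consists of
  a positive bump at \<open>p\<close> and a negative one at \<open>q\<close>.\<close>

lemma du_Bois_Reymond_le:
  fixes g :: "real \<Rightarrow> real"
  assumes "0 < b" and g: "continuous_on {-b..b} g"
    and orth: "\<And>\<psi>. \<psi> \<in> test_functions b \<Longrightarrow> integral\<^sup>L (leb_interval b) (\<lambda>x. g x * deriv \<psi> x) = 0"
    and p: "p \<in> {-b<..<b}" and q: "q \<in> {-b<..<b}"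
  shows "g p \<le> g q"
proof (rule ccontr)
  assume "\<not> g p \<le> g q"
  \<comment> \<open>A quarter of the gap: close to p the function exceeds m + \<eta>, and close to q
    it stays below m - \<eta>.\<close>
  define \<eta> where "\<eta> = (g p - g q) / 4"
  define m where "m = (g p + g q) / 2"
  have \<eta>: "\<eta> > 0" "g p = m + 2 * \<eta>" "g q = m - 2 * \<eta>"
    using \<open>\<not> g p \<le> g q\<close> by (auto simp: \<eta>_def m_def field_simps)
  have near: "\<exists>d>0. \<forall>y. \<bar>y - x\<bar> < d \<longrightarrow> \<bar>g y - g x\<bar> < \<eta>" if "x \<in> {-b<..<b}" for x
  proof -
    have "isCont g x" using g that by (intro continuous_on_interior) auto
    then show ?thesis using \<eta>(1) by (auto simp: continuous_at_eps_delta dist_real_def)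
  qed
  from near[OF p] near[OF q] obtain d1 d2 where
    d1: "d1 > 0" "\<And>y. \<bar>y - p\<bar> < d1 \<Longrightarrow> \<bar>g y - g p\<bar> < \<eta>" and
    d2: "d2 > 0" "\<And>y. \<bar>y - q\<bar> < d2 \<Longrightarrow> \<bar>g y - g q\<bar> < \<eta>" by blast
  \<comment> \<open>Halving makes bumps of radius \<epsilon> fit strictly inside both neighbourhoods
    and inside the open interval.\<close>
  define \<epsilon> where "\<epsilon> = min (min d1 d2) (min (b - \<bar>p\<bar>) (b - \<bar>q\<bar>)) / 2"
  have \<epsilon>: "\<epsilon> > 0" "\<epsilon> < d1" "\<epsilon> < d2" "\<epsilon> < b - \<bar>p\<bar>" "\<epsilon> < b - \<bar>q\<bar>"
    using d1(1) d2(1) p q by (auto simp: \<epsilon>_def min_def)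
  obtain T T' where "smooth_sgn \<epsilon> T T'" using smooth_sgn_exists[OF \<epsilon>(1)] by blast
  note T = smooth_sgnD[OF this]
  define \<psi> where "\<psi> = (\<lambda>x. T (x - p) - T (x - q))"
  have shift: "((\<lambda>x. T (x - c)) has_real_derivative T' (x - c)) (at x)" for c x
    using DERIV_shift[of T "T' (x - c)" x "- c"] T(3) by simp
  have "\<psi> \<in> test_functions b"
  proof (rule smooth_test_function)
    show "\<psi> \<in> smooth"
      using smooth_diff[OF smooth_affine[OF T(1), of 1 "- p"] smooth_affine[OF T(1), of 1 "- q"]]
      by (simp add: \<psi>_def)
    show "max \<bar>p\<bar> \<bar>q\<bar> + \<epsilon> < b" using \<epsilon> by auto
    fix x assume "max \<bar>p\<bar> \<bar>q\<bar> + \<epsilon> < \<bar>x\<bar>"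
    then have "(\<epsilon> \<le> x - p \<and> \<epsilon> \<le> x - q) \<or> (x - p \<le> - \<epsilon> \<and> x - q \<le> - \<epsilon>)" by linarith
    then show "\<psi> x = 0" using T(8,9) by (auto simp: \<psi>_def)
  qed
  moreover have "deriv \<psi> = (\<lambda>x. T' (x - p) - T' (x - q))"
    unfolding \<psi>_def by (rule ext, rule DERIV_imp_deriv, intro DERIV_diff shift)
  ultimately have int0: "integral\<^sup>L (leb_interval b) (\<lambda>x. g x * (T' (x - p) - T' (x - q))) = 0"
    using orth by fastforce
  have L2_shift: "(\<lambda>x. T' (x - c)) \<in> L2 b" for c
    using smooth_affine[OF T(2), of 1 "- c"] by (intro continuous_on_L2 smooth_continuous_on) simp
  have one: "(\<lambda>_. 1) \<in> L2 b" by (rule continuous_on_L2) simp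
  have integrable_shift: "integrable (leb_interval b) (\<lambda>x. T' (x - c))" for c
    using integrable_mult_L2[OF one L2_shift[of c]] by simp
  have integrable_g: "integrable (leb_interval b) (\<lambda>x. g x * T' (x - c))" for c
    by (rule integrable_mult_L2[OF continuous_on_L2[OF g] L2_shift])
  \<comment> \<open>T passes from - 1 to 1 within the interval, so each bump has mass 2.\<close>
  have int2: "integral\<^sup>L (leb_interval b) (\<lambda>x. T' (x - c)) = 2" if "\<epsilon> < b - \<bar>c\<bar>" for c
  proof -
    have "integral\<^sup>L (leb_interval b) (\<lambda>x. T' (x - c)) = T (b - c) - T (- b - c)"
    proof (rule fundamental_theorem_leb_interval[OF assms(1) finite.emptyI _ shift integrable_shift])
      show "continuous_on {-b..b} (\<lambda>x. T (x - c))"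
        by (rule DERIV_continuous_on[OF has_field_derivative_at_within[OF shift]])
    qed
    also have "\<dots> = 2" using T(8)[of "b - c"] T(9)[of "- b - c"] that by simp
    finally show ?thesis .
  qed
  \<comment> \<open>The integrand is nonnegative by the choice of the neighbourhoods, yet
    orthogonality and the masses of the bumps make its integral - 4 \<eta>.\<close>
  have "0 \<le> integral\<^sup>L (leb_interval b) (\<lambda>x. g x * (T' (x - p) - T' (x - q)) - (m + \<eta>) * T' (x - p) + (m - \<eta>) * T' (x - q))"
  proof (rule integral_nonneg_AE, rule AE_I2)
    fix x
    have "0 \<le> (g x - m - \<eta>) * T' (x - p)"
    proof (cases "\<bar>x - p\<bar> < d1")
      case True
      then have "0 \<le> g x - m - \<eta>" using d1(2)[of x] \<eta> by linarith
      then show ?thesis using T(4) by simp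
    next
      case False
      then show ?thesis using T(5)[of "x - p"] \<epsilon> by simp
    qed
    moreover have "0 \<le> (m - \<eta> - g x) * T' (x - q)"
    proof (cases "\<bar>x - q\<bar> < d2")
      case True
      then have "0 \<le> m - \<eta> - g x" using d2(2)[of x] \<eta> by linarith
      then show ?thesis using T(4) by simp
    next
      case False
      then show ?thesis using T(5)[of "x - q"] \<epsilon> by simp
    qed
    ultimately show "0 \<le> g x * (T' (x - p) - T' (x - q)) - (m + \<eta>) * T' (x - p) + (m - \<eta>) * T' (x - q)"
      by (simp add: algebra_simps)
  qed
  also have "\<dots> = 0 - (m + \<eta>) * 2 + (m - \<eta>) * 2"
    using int0 int2[OF \<epsilon>(4)] int2[OF \<epsilon>(5)] integrable_shift integrable_g
    by (simp add: right_diff_distrib)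
  finally show False using \<eta>(1) by simp
qed

text \<open>The definition ties \<open>u\<close> to v only through integrals against test functions.
  The kernel formula for v defines a uniform limit w of the approximations, hence a continuous
  function with zero boundary values; as \<open>u\<close> and w share the weak derivative v, they
  differ by a constant, which is zero.\<close>

lemma W012_representation:
  assumes "0 < b" "u \<in> W012 b"
  obtains v \<phi> where "weak_derivative_L2 b u v" "\<And>n. \<phi> n \<in> test_functions b"
    "(\<lambda>n. norm_L2 b (\<lambda>x. v x - deriv (\<phi> n) x)) \<longlonglongrightarrow> 0"
    "\<And>x. x \<in> {-b..b} \<Longrightarrow> u x = integral\<^sup>L (leb_interval b) (\<lambda>t. v t * kernel b x t)"
    "\<And>n x. x \<in> {-b..b} \<Longrightarrow> \<bar>\<phi> n x - u x\<bar> \<le> sqrt b / real (Suc n)"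
proof -
  from assms(2) obtain v where u: "continuous_on {-b..b} u" "u (- b) = 0" "u b = 0"
    and weak: "weak_derivative_L2 b u v"
    and approx: "\<And>\<epsilon>. \<epsilon> > 0 \<Longrightarrow> \<exists>\<phi>\<in>test_functions b. norm_L2 b (\<lambda>x. v x - deriv \<phi> x) < \<epsilon>"
    unfolding W012_def by blast
  have v: "v \<in> L2 b" using weak by (simp add: weak_derivative_L2_def)
  have "\<forall>n. \<exists>\<phi>\<in>test_functions b. norm_L2 b (\<lambda>x. v x - deriv \<phi> x) < 1 / real (Suc n)"
    using approx by simp
  then obtain \<phi> where \<phi>: "\<And>n. \<phi> n \<in> test_functions b"
    "\<And>n. norm_L2 b (\<lambda>x. v x - deriv (\<phi> n) x) < 1 / real (Suc n)" by metis
  have d\<phi>: "deriv (\<phi> n) \<in> L2 b" for n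
    by (intro test_function_L2 deriv_test_function \<phi>)
  have lim: "(\<lambda>n. norm_L2 b (\<lambda>x. v x - deriv (\<phi> n) x)) \<longlonglongrightarrow> 0"
  proof (rule tendsto_sandwich[OF _ _ tendsto_const])
    show "\<forall>\<^sub>F n in sequentially. 0 \<le> norm_L2 b (\<lambda>x. v x - deriv (\<phi> n) x)"
      by (simp add: norm_L2_eq)
    show "\<forall>\<^sub>F n in sequentially. norm_L2 b (\<lambda>x. v x - deriv (\<phi> n) x) \<le> 1 / real (Suc n)"
      using \<phi>(2) by (simp add: less_imp_le)
    show "(\<lambda>n. 1 / real (Suc n)) \<longlonglongrightarrow> 0"
      using LIMSEQ_Suc[OF lim_1_over_n] .
  qed
  define w where "w = (\<lambda>x. integral\<^sup>L (leb_interval b) (\<lambda>t. v t * kernel b x t))"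
  have close: "\<bar>\<phi> n x - w x\<bar> \<le> sqrt b / real (Suc n)" if x: "x \<in> {-b..b}" for n x
  proof -
    have "w x - \<phi> n x = integral\<^sup>L (leb_interval b) (\<lambda>t. (v t - deriv (\<phi> n) t) * kernel b x t)"
      unfolding w_def test_function_kernel[OF assms(1) x \<phi>(1)[of n]]
      using v d\<phi> kernel_L2 by (simp add: left_diff_distrib integrable_mult_L2)
    then have "\<bar>\<phi> n x - w x\<bar> \<le> norm_L2 b (\<lambda>t. v t - deriv (\<phi> n) t) * norm_L2 b (kernel b x)"
      using abs_integral_mult_le[OF diff_L2[OF v d\<phi>[of n]] kernel_L2[of b x]] by (simp add: abs_minus_commute)
    also have "\<dots> \<le> 1 / real (Suc n) * sqrt b"
      using \<phi>(2)[of n] norm_kernel_le[OF assms(1) x]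
      by (intro mult_mono) (auto simp: norm_L2_eq less_imp_le)
    finally show ?thesis by simp
  qed
  have unif: "uniform_limit {-b..b} \<phi> w sequentially"
  proof (rule uniform_limitI)
    fix e :: real assume "0 < e"
    have "(\<lambda>n. sqrt b * (1 / real (Suc n))) \<longlonglongrightarrow> sqrt b * 0"
      by (intro tendsto_mult_left LIMSEQ_Suc[OF lim_1_over_n])
    then have "\<forall>\<^sub>F n in sequentially. sqrt b / real (Suc n) < e"
      using \<open>0 < e\<close> by (intro order_tendstoD(2)[of _ 0]) simp_all
    then show "\<forall>\<^sub>F n in sequentially. \<forall>x\<in>{-b..b}. dist (\<phi> n x) (w x) < e"
      by eventually_elim (metis close dist_real_def order.strict_trans1)
  qed
  have w: "continuous_on {-b..b} w"
    by (rule uniform_limit_theorem[OF _ unif]) (auto intro: always_eventually test_function_continuous_on[OF \<phi>(1)])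
  have w_bd: "w (- b) = 0" "w b = 0"
  proof -
    have "w x = 0" if "\<bar>x\<bar> = b" for x
    proof (rule LIMSEQ_unique)
      have "x \<in> {-b..b}" using that by auto
      then show "(\<lambda>n. \<phi> n x) \<longlonglongrightarrow> w x" using tendsto_uniform_limitI[OF unif] by blast
      show "(\<lambda>n. \<phi> n x) \<longlonglongrightarrow> 0" using test_function_eq_0[OF \<phi>(1)] that by simp
    qed
    then show "w (- b) = 0" "w b = 0" using assms(1) by auto
  qed
  obtain C where C: "\<And>x. x \<in> {-b..b} \<Longrightarrow> \<bar>w x\<bar> \<le> C"
    by (rule continuous_on_bounded_Icc[OF w]) blast
  \<comment> \<open>Integration by parts holds for each \<open>\<phi> n\<close>. Both sides pass to
    the limit, by uniform convergence of \<open>\<phi> n\<close> and by L^2 convergence of its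
    derivative, so v is a weak derivative of w as well.\<close>
  have orth: "integral\<^sup>L (leb_interval b) (\<lambda>x. (u x - w x) * deriv \<psi> x) = 0"
    if \<psi>: "\<psi> \<in> test_functions b" for \<psi>
  proof -
    have d\<psi>: "deriv \<psi> \<in> L2 b" and \<psi>2: "\<psi> \<in> L2 b"
      by (intro test_function_L2 deriv_test_function \<psi>)+
    have "(\<lambda>n. norm_L2 b (\<lambda>x. w x - \<phi> n x)) \<longlonglongrightarrow> 0"
    proof (rule tendsto_sandwich[OF _ _ tendsto_const])
      \<comment> \<open>The factor \<open>2 * b\<close> is the length of the interval.\<close>
      show "\<forall>\<^sub>F n in sequentially. norm_L2 b (\<lambda>x. w x - \<phi> n x) \<le> sqrt (b / (real (Suc n))\<^sup>2 * (2 * b))"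
      proof (rule always_eventually, rule allI)
        fix n
        have "integral\<^sup>L (leb_interval b) (\<lambda>x. (w x - \<phi> n x)\<^sup>2) \<le> integral\<^sup>L (leb_interval b) (\<lambda>x. b / (real (Suc n))\<^sup>2)"
        proof (rule integral_mono_AE)
          show "integrable (leb_interval b) (\<lambda>x. (w x - \<phi> n x)\<^sup>2)"
            using diff_L2[OF continuous_on_L2[OF w] test_function_L2[OF \<phi>(1)[of n]]] by (simp add: L2_iff)
          show "AE x in leb_interval b. (w x - \<phi> n x)\<^sup>2 \<le> b / (real (Suc n))\<^sup>2"
          proof (rule AE_I2)
            fix x assume "x \<in> space (leb_interval b)"
            then have "\<bar>w x - \<phi> n x\<bar>\<^sup>2 \<le> (sqrt b / real (Suc n))\<^sup>2"
              using close[of x n] by (intro power_mono) (auto simp: abs_minus_commute)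
            then show "(w x - \<phi> n x)\<^sup>2 \<le> b / (real (Suc n))\<^sup>2"
              using assms(1) by (simp add: power_divide)
          qed
        qed (simp add: finite_measure.integrable_const[OF finite_measure_leb_interval])
        also have "\<dots> = b / (real (Suc n))\<^sup>2 * (2 * b)"
          using assms(1) by (simp add: measure_leb_interval)
        finally show "norm_L2 b (\<lambda>x. w x - \<phi> n x) \<le> sqrt (b / (real (Suc n))\<^sup>2 * (2 * b))"
          by (simp add: norm_L2_eq)
      qed
      have "(\<lambda>n. sqrt (b * (1 / real (Suc n))\<^sup>2 * (2 * b))) \<longlonglongrightarrow> sqrt (b * 0\<^sup>2 * (2 * b))"
        by (intro tendsto_intros LIMSEQ_Suc[OF lim_1_over_n])
      then show "(\<lambda>n. sqrt (b / (real (Suc n))\<^sup>2 * (2 * b))) \<longlonglongrightarrow> 0"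
        by (simp add: power_divide)
    qed (simp add: norm_L2_eq)
    then have "(\<lambda>n. integral\<^sup>L (leb_interval b) (\<lambda>x. \<phi> n x * deriv \<psi> x)) \<longlonglongrightarrow>
        integral\<^sup>L (leb_interval b) (\<lambda>x. w x * deriv \<psi> x)"
      by (intro integral_mult_tendsto test_function_L2 \<phi> continuous_on_L2 w d\<psi>)
    moreover have "(\<lambda>n. - integral\<^sup>L (leb_interval b) (\<lambda>x. deriv (\<phi> n) x * \<psi> x)) \<longlonglongrightarrow>
        - integral\<^sup>L (leb_interval b) (\<lambda>x. v x * \<psi> x)"
      by (intro tendsto_minus integral_mult_tendsto d\<phi> v \<psi>2 lim)
    moreover have "integral\<^sup>L (leb_interval b) (\<lambda>x. \<phi> n x * deriv \<psi> x) =
        - integral\<^sup>L (leb_interval b) (\<lambda>x. deriv (\<phi> n) x * \<psi> x)" for n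
      by (rule test_function_integration_by_parts[OF assms(1) \<psi> finite.emptyI
            test_function_continuous_on[OF \<phi>(1)] test_function_DERIV[OF \<phi>(1)] d\<phi>])
    ultimately have "integral\<^sup>L (leb_interval b) (\<lambda>x. w x * deriv \<psi> x) = - integral\<^sup>L (leb_interval b) (\<lambda>x. v x * \<psi> x)"
      by (simp add: LIMSEQ_unique)
    moreover have "integral\<^sup>L (leb_interval b) (\<lambda>x. u x * deriv \<psi> x) = - integral\<^sup>L (leb_interval b) (\<lambda>x. v x * \<psi> x)"
      using weak \<psi> by (simp add: weak_derivative_L2_def LINT_leb_interval)
    ultimately show ?thesis
      using integrable_mult_L2[OF continuous_on_L2[OF u(1)] d\<psi>] integrable_mult_L2[OF continuous_on_L2[OF w] d\<psi>]
      by (simp add: left_diff_distrib)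
  qed
  have g: "continuous_on {-b..b} (\<lambda>x. u x - w x)" by (intro continuous_intros u w)
  \<comment> \<open>The one-sided comparison is applied in both directions.\<close>
  have const: "u x - w x = u 0 - w 0" if "x \<in> {-b<..<b}" for x
    using du_Bois_Reymond_le[OF assms(1) g orth that, of 0] du_Bois_Reymond_le[OF assms(1) g orth _ that, of 0] assms(1)
    by simp
  \<comment> \<open>Continuity carries the constant to the end points, where both functions
    vanish.\<close>
  have const': "u x - w x = u 0 - w 0" if "x \<in> {-b..b}" for x
  proof (rule continuous_constant_on_closure[of "{-b<..<b}" "\<lambda>x. u x - w x"])
    show "continuous_on (closure {-b<..<b}) (\<lambda>x. u x - w x)" using g assms(1) by simp
    show "x \<in> closure {-b<..<b}" using that assms(1) by simp
  qed (rule const)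
  have "u 0 - w 0 = 0" using const'[of b] u w_bd assms(1) by simp
  then have uw: "u x = w x" if "x \<in> {-b..b}" for x
    using const'[OF that] by simp
  show ?thesis
  proof (rule that[OF weak \<phi>(1) lim])
    show "u x = integral\<^sup>L (leb_interval b) (\<lambda>t. v t * kernel b x t)" if "x \<in> {-b..b}" for x
      using uw[OF that] by (simp add: w_def)
    show "\<bar>\<phi> n x - u x\<bar> \<le> sqrt b / real (Suc n)" if "x \<in> {-b..b}" for n x
      using close[OF that] uw[OF that] by simp
  qed
qed

section \<open>The lower bound\<close>

context
  fixes b :: real and V u
  assumes b: "0 < b" and V: "V \<in> finite_signed_measures b" and sol: "nontrivial_solution b V u"
begin

private abbreviation (input) "P \<equiv> positive_part (borel_interval b) V"

lemma V_signed: "signed_measure (borel_interval b) V"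
  and V_finite: "total_variation (borel_interval b) V (space (borel_interval b)) < \<infinity>"
  using V by (simp_all add: finite_signed_measures_def)

interpretation P: finite_measure P
  by (rule finite_measure_positive_part[OF V_signed V_finite])

lemma integrable_positive_part_bounded:
  fixes f :: "real \<Rightarrow> real"
  assumes "f \<in> borel_measurable (borel_interval b)" "\<And>x. x \<in> {-b<..<b} \<Longrightarrow> \<bar>f x\<bar> \<le> C"
  shows "integrable P f"
  by (rule P.integrable_const_bound[of _ C]) (use assms in \<open>auto intro!: AE_I2\<close>)

lemma borel_interval_square: "(\<lambda>x. x\<^sup>2) \<in> borel_measurable (borel_interval b)"
  by (intro measurable_restrict_space1) simp

lemma integrable_square: "integrable P (\<lambda>x. x\<^sup>2)"
proof (rule integrable_positive_part_bounded[of _ "b\<^sup>2", OF borel_interval_square])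
  show "\<bar>x\<^sup>2\<bar> \<le> b\<^sup>2" if "x \<in> {-b<..<b}" for x
    using power_mono[of "\<bar>x\<bar>" b 2] that by auto
qed

text \<open>Testing the equation with \<open>u\<close> gives \<open>\<integral> v\<^sup>2 = \<integral> u\<^sup>2 dV \<le> \<integral> u\<^sup>2 dV\<^sup>+\<close>, and \<open>u\<^sup>2\<close> is bounded
  by \<open>\<integral> v\<^sup>2\<close> times the Green function.\<close>

lemma positive_part_integral_ge: "2 * b \<le> integral\<^sup>L P (\<lambda>x. b\<^sup>2 - x\<^sup>2)"
proof -
  have u: "u \<in> W012 b" using sol by (simp add: nontrivial_solution_def)
  then have cu: "continuous_on {-b..b} u" by (simp add: W012_def)
  obtain v \<phi> where weak: "weak_derivative_L2 b u v" and \<phi>: "\<And>n. \<phi> n \<in> test_functions b"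
    and lim: "(\<lambda>n. norm_L2 b (\<lambda>x. v x - deriv (\<phi> n) x)) \<longlonglongrightarrow> 0"
    and repr: "\<And>x. x \<in> {-b..b} \<Longrightarrow> u x = integral\<^sup>L (leb_interval b) (\<lambda>t. v t * kernel b x t)"
    and close: "\<And>n x. x \<in> {-b..b} \<Longrightarrow> \<bar>\<phi> n x - u x\<bar> \<le> sqrt b / real (Suc n)"
    by (rule W012_representation[OF b u]) blast
  obtain v2 where weak2: "weak_derivative_L2 b u v2"
    and eq: "\<And>\<psi>. \<psi> \<in> test_functions b \<Longrightarrow> integral\<^sup>L (leb_interval b) (\<lambda>x. v2 x * deriv \<psi> x) =
      signed_integral (borel_interval b) V (\<lambda>x. u x * \<psi> x)"
    using sol unfolding nontrivial_solution_def distributional_solution_def LINT_leb_interval by blast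
  have v: "v \<in> L2 b" using weak by (simp add: weak_derivative_L2_def)
  define K where "K = integral\<^sup>L (leb_interval b) (\<lambda>x. (v x)\<^sup>2)"
  have "(\<lambda>n. integral\<^sup>L (leb_interval b) (\<lambda>x. deriv (\<phi> n) x * v x)) \<longlonglongrightarrow> integral\<^sup>L (leb_interval b) (\<lambda>x. v x * v x)"
    by (rule integral_mult_tendsto[OF test_function_L2[OF deriv_test_function[OF \<phi>]] v v lim])
  moreover have "integral\<^sup>L (leb_interval b) (\<lambda>x. deriv (\<phi> n) x * v x) =
      signed_integral (borel_interval b) V (\<lambda>x. u x * \<phi> n x)" for n
  proof -
    \<comment> \<open>The equation may come with another weak derivative \<open>v2\<close>. Since
      \<open>deriv (\<phi> n)\<close> is itself a test function, its pairings with \<open>v\<close>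
      and \<open>v2\<close> agree, which makes almost everywhere uniqueness unnecessary.\<close>
    have parts: "integral\<^sup>L (leb_interval b) (\<lambda>x. u x * deriv (deriv (\<phi> n)) x) =
        - integral\<^sup>L (leb_interval b) (\<lambda>x. w x * deriv (\<phi> n) x)" if "weak_derivative_L2 b u w" for w
      using that deriv_test_function[OF \<phi>[of n]]
      by (simp add: weak_derivative_L2_def LINT_leb_interval)
    have "integral\<^sup>L (leb_interval b) (\<lambda>x. v x * deriv (\<phi> n) x) = integral\<^sup>L (leb_interval b) (\<lambda>x. v2 x * deriv (\<phi> n) x)"
      using parts[OF weak] parts[OF weak2] by simp
    then show ?thesis using eq[OF \<phi>[of n]] by (simp add: mult.commute)
  qed
  ultimately have limK: "(\<lambda>n. signed_integral (borel_interval b) V (\<lambda>x. u x * \<phi> n x)) \<longlonglongrightarrow> K"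
    by (simp add: K_def power2_eq_square)
  obtain C where C: "\<And>x. x \<in> {-b..b} \<Longrightarrow> \<bar>u x\<bar> \<le> C"
    by (rule continuous_on_bounded_Icc[OF cu]) blast
  have mu: "u \<in> borel_measurable (borel_interval b)"
    by (rule borel_measurable_continuous_on_restrict[OF continuous_on_subset[OF cu]]) auto
  have m\<phi>: "\<phi> n \<in> borel_measurable (borel_interval b)" for n
    by (rule borel_measurable_continuous_on_restrict[OF test_function_continuous_on[OF \<phi>]])
  \<comment> \<open>Uniform closeness gives pointwise convergence and, as \<open>\<phi> n\<close>
    stays within \<open>sqrt b\<close> of \<open>u\<close>, a constant majorant.\<close>
  have "(\<lambda>n. signed_integral (borel_interval b) V (\<lambda>x. u x * \<phi> n x)) \<longlonglongrightarrow>
      signed_integral (borel_interval b) V (\<lambda>x. u x * u x)"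
  proof (rule signed_integral_tendsto[OF V_signed V_finite, where C = "C * (C + sqrt b)"])
    show "(\<lambda>x. u x * \<phi> n x) \<in> borel_measurable (borel_interval b)" for n
      using mu m\<phi> by measurable
    show "(\<lambda>x. u x * u x) \<in> borel_measurable (borel_interval b)"
      using mu by measurable
    fix x assume "x \<in> space (borel_interval b)"
    then have x: "x \<in> {-b..b}" by auto
    have lim0: "(\<lambda>n. sqrt b / real (Suc n)) \<longlonglongrightarrow> 0"
      using tendsto_mult_right_zero[OF LIMSEQ_Suc[OF lim_1_over_n], of "sqrt b"] by simp
    have "(\<lambda>n. \<phi> n x - u x) \<longlonglongrightarrow> 0"
      by (rule Lim_null_comparison[OF _ lim0]) (use close[OF x] in \<open>auto intro: always_eventually\<close>)
    then show "(\<lambda>n. u x * \<phi> n x) \<longlonglongrightarrow> u x * u x"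
      by (intro tendsto_mult_left) (rule LIM_zero_cancel)
    fix n
    have "sqrt b / real (Suc n) \<le> sqrt b / 1"
      using b by (intro frac_le) auto
    then have "\<bar>\<phi> n x\<bar> \<le> C + sqrt b"
      using close[OF x, of n] C[OF x] by linarith
    then show "\<bar>u x * \<phi> n x\<bar> \<le> C * (C + sqrt b)"
      unfolding abs_mult using C[OF x] by (intro mult_mono) auto
  qed
  then have "K = signed_integral (borel_interval b) V (\<lambda>x. u x * u x)"
    by (rule LIMSEQ_unique[OF limK])
  also have "\<dots> \<le> integral\<^sup>L P (\<lambda>x. u x * u x)"
    by (rule signed_integral_le_positive_part) simp
  finally have K_le: "K \<le> integral\<^sup>L P (\<lambda>x. u x * u x)" .
  have u_le: "u x * u x \<le> K / (2 * b) * (b\<^sup>2 - x\<^sup>2)" if "x \<in> {-b..b}" for x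
    using Cauchy_Schwarz_L2[OF v kernel_L2[of b x]]
    unfolding repr[OF that, symmetric] integral_kernel_square[OF b that] K_def[symmetric]
    by (simp add: power2_eq_square)
  obtain x0 where x0: "x0 \<in> {-b<..<b}" "u x0 \<noteq> 0"
    using sol by (auto simp: nontrivial_solution_def)
  \<comment> \<open>Otherwise the pointwise bound would make \<open>u\<close> vanish. Positivity is
    what allows K to be cancelled at the end.\<close>
  have "K > 0"
  proof (rule ccontr)
    assume "\<not> 0 < K"
    moreover have "K \<ge> 0" by (simp add: K_def)
    ultimately have "u x0 * u x0 \<le> 0" using u_le[of x0] x0(1) by simp
    then show False using x0(2) by (auto simp: mult_le_0_iff)
  qed
  have "K \<le> integral\<^sup>L P (\<lambda>x. K / (2 * b) * (b\<^sup>2 - x\<^sup>2))"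
  proof (rule order_trans[OF K_le], rule integral_mono_AE)
    show "integrable P (\<lambda>x. u x * u x)"
    proof (rule integrable_positive_part_bounded)
      show "(\<lambda>x. u x * u x) \<in> borel_measurable (borel_interval b)" using mu by measurable
      show "\<bar>u x * u x\<bar> \<le> C * C" if "x \<in> {-b<..<b}" for x
        unfolding abs_mult using C[of x] that by (intro mult_mono) auto
    qed
    show "integrable P (\<lambda>x. K / (2 * b) * (b\<^sup>2 - x\<^sup>2))"
      using integrable_square by simp
    show "AE x in P. u x * u x \<le> K / (2 * b) * (b\<^sup>2 - x\<^sup>2)"
      using u_le by (intro AE_I2) auto
  qed
  also have "\<dots> = K / (2 * b) * integral\<^sup>L P (\<lambda>x. b\<^sup>2 - x\<^sup>2)" by simp
  finally have "K * (2 * b) \<le> K * integral\<^sup>L P (\<lambda>x. b\<^sup>2 - x\<^sup>2)"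
    using b by (simp add: field_simps)
  then show ?thesis using \<open>K > 0\<close> by simp
qed

lemma measure_positive_part_le_norm: "measure P {-b<..<b} \<le> norm_M b V"
  using measure_positive_part_le[OF V_signed V_finite, of "{-b<..<b}"]
  by (simp add: norm_M_def sets_borel_interval)

lemma integral_positive_part_eq:
  "integral\<^sup>L P (\<lambda>x. b\<^sup>2 - x\<^sup>2) = b\<^sup>2 * measure P {-b<..<b} - integral\<^sup>L P (\<lambda>x. x\<^sup>2)"
  using integrable_square by simp

lemma norm_M_ge: "2 \<le> b * norm_M b V"
proof -
  have "0 \<le> integral\<^sup>L P (\<lambda>x. x\<^sup>2)" by simp
  then have "2 * b \<le> b\<^sup>2 * measure P {-b<..<b}"
    using positive_part_integral_ge integral_positive_part_eq by linarith
  also have "\<dots> \<le> b\<^sup>2 * norm_M b V"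
    using measure_positive_part_le_norm by (intro mult_left_mono) auto
  finally have "b * 2 \<le> b * (b * norm_M b V)" by (simp add: power2_eq_square mult_ac)
  then show ?thesis using b by simp
qed

text \<open>Equality forces the positive part to be concentrated at the origin.\<close>

lemma norm_M_neq:
  assumes "total_variation (borel_interval b) V {0} = 0"
  shows "b * norm_M b V \<noteq> 2"
proof
  assume "b * norm_M b V = 2"
  then have "b\<^sup>2 * norm_M b V = 2 * b" by (simp add: power2_eq_square mult.assoc)
  moreover have "b\<^sup>2 * measure P {-b<..<b} \<le> b\<^sup>2 * norm_M b V"
    using measure_positive_part_le_norm by (intro mult_left_mono) auto
  \<comment> \<open>Equality leaves no room for a second moment of the positive part.\<close>
  ultimately have "integral\<^sup>L P (\<lambda>x. x\<^sup>2) \<le> 0"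
    using positive_part_integral_ge integral_positive_part_eq by linarith
  moreover have "0 \<le> integral\<^sup>L P (\<lambda>x. x\<^sup>2)" by simp
  ultimately have "AE x in P. x\<^sup>2 = 0"
    using integral_nonneg_eq_0_iff_AE[OF integrable_square] by simp
  moreover have "AE x in P. x \<notin> {0}"
  proof (rule AE_not_in)
    have s: "{0} \<in> sets (borel_interval b)" using b by (simp add: sets_borel_interval)
    have "measure P {0} \<le> 0"
      using measure_positive_part_le[OF V_signed V_finite s] assms by simp
    then have "emeasure P {0} = 0"
      by (simp add: P.emeasure_eq_measure measure_le_0_iff)
    then show "{0} \<in> null_sets P" using s by auto
  qed
  \<comment> \<open>Almost everywhere x is both zero and nonzero, so every integral is 0, against
    the lower bound \<open>2 * b\<close>.\<close>
  ultimately have "AE x in P. b\<^sup>2 - x\<^sup>2 = 0" by eventually_elim simp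
  then have "integral\<^sup>L P (\<lambda>x. b\<^sup>2 - x\<^sup>2) = 0" by (rule integral_eq_zero_AE)
  then show False using positive_part_integral_ge b by simp
qed

end

section \<open>Tent functions\<close>

lemma antiderivative_exists:
  fixes f :: "real \<Rightarrow> real"
  assumes "continuous_on UNIV f"
  shows "\<exists>F. \<forall>x. (F has_real_derivative f x) (at x)"
proof -
  have "\<exists>F. \<forall>x. -\<infinity> < ereal x \<longrightarrow> ereal x < \<infinity> \<longrightarrow> (F has_vector_derivative f x) (at x)"
    using assms by (intro einterval_antiderivative) (auto simp: continuous_on_eq_continuous_at)
  then show ?thesis by (simp add: has_real_derivative_iff_has_vector_derivative)
qed

text \<open>A primitive of an odd function is even, so normalising it at b makes it vanish at - b
  too, without evaluating any integral.\<close>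

lemma odd_antiderivative_exists:
  fixes f :: "real \<Rightarrow> real"
  assumes "continuous_on UNIV f" and odd: "\<And>x. f (- x) = - f x"
  shows "\<exists>F. (\<forall>x. (F has_real_derivative f x) (at x)) \<and> F b = 0 \<and> (\<forall>x. F (- x) = F x)"
proof -
  obtain G where G: "\<And>x. (G has_real_derivative f x) (at x)"
    using antiderivative_exists[OF assms(1)] by blast
  define F where "F = (\<lambda>x. G x - G b)"
  have F: "(F has_real_derivative f x) (at x)" for x
    unfolding F_def using DERIV_diff[OF G DERIV_const] by simp
  have "((\<lambda>x. F (- x) - F x) has_real_derivative 0) (at x)" for x
  proof -
    have "((\<lambda>x. F (- x)) has_real_derivative f (- x) * (- 1)) (at x)"
      by (rule DERIV_chain2[OF F]) (auto intro!: derivative_eq_intros)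
    from DERIV_diff[OF this F[of x]] show ?thesis by (simp add: odd)
  qed
  then have "F (- x) - F x = F (- 0) - F 0" for x
    using DERIV_isconst_all[of "\<lambda>x. F (- x) - F x" x 0] by blast
  then show ?thesis using F by (intro exI[of _ F]) (simp add: F_def)
qed

lemma DERIV_zero_right_half_line:
  fixes F :: "real \<Rightarrow> real"
  assumes "\<And>x. (F has_real_derivative f x) (at x)" "\<And>x. a < x \<Longrightarrow> f x = 0" "a \<le> x"
  shows "F x = F a"
proof (cases "a = x")
  case False
  show ?thesis
  proof (rule DERIV_isconst_end[of a x F])
    show "a < x" using assms(3) False by simp
    show "continuous_on {a..x} F"
      by (rule DERIV_continuous_on[OF has_field_derivative_at_within[OF assms(1)]])
    show "(F has_real_derivative 0) (at y)" if "a < y" "y < x" for y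
      using assms(1)[of y] assms(2)[OF that(1)] by simp
  qed
qed simp

lemma integral_indicator_Icc_le:
  assumes "p \<le> q"
  shows "integral\<^sup>L (leb_interval b) (indicat_real {p..q}) \<le> q - p"
    and "integrable (leb_interval b) (indicat_real {p..q})"
proof -
  have m: "indicat_real {p..q} \<in> borel_measurable (leb_interval b)"
    by (intro borel_measurable_leb_interval) simp
  show "integrable (leb_interval b) (indicat_real {p..q})"
    by (rule integrable_bounded_leb_interval[OF m, of 1]) (simp add: indicator_def)
  have "integral\<^sup>L (leb_interval b) (indicat_real {p..q}) = measure lebesgue ({-b<..<b} \<inter> {p..q})"
    by (subst integral_restrict_space) (simp_all add: indicator_inter_arith[symmetric])
  also have "\<dots> \<le> measure lebesgue {p..q}"
    by (intro measure_mono_fmeasurable) (auto simp: fmeasurable_cbox[of p q, simplified])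
  also have "\<dots> = q - p" using assms by simp
  finally show "integral\<^sup>L (leb_interval b) (indicat_real {p..q}) \<le> q - p" .
qed

text \<open>The approximating derivative is \<open>c (R - T)\<close>, where the odd function \<open>R\<close> vanishes except near
  the end points and cancels \<open>T\<close> there; oddness makes its primitive vanish at both ends.\<close>

lemma test_function_approximation:
  assumes b: "0 < b" and \<delta>: "0 < \<delta>" "4 * \<delta> \<le> b"
    and T: "smooth_sgn e T T'" "2 * e \<le> b"
    and v: "v \<in> L2 b" "\<And>x. \<bar>v x\<bar> \<le> \<bar>c\<bar>" "\<And>x. \<delta> < \<bar>x\<bar> \<Longrightarrow> v x = - c * T x"
  shows "\<exists>\<phi>\<in>test_functions b. norm_L2 b (\<lambda>x. v x - deriv \<phi> x) \<le> sqrt (72 * c\<^sup>2 * \<delta>)"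
proof -
  note T = smooth_sgnD[OF T(1)] T(2)
  obtain S S' where "smooth_sgn \<delta> S S'" using smooth_sgn_exists[OF \<delta>(1)] by blast
  note S = smooth_sgnD[OF this]
  \<comment> \<open>The cut-off changes from 0 to 1 on [a - \<delta>, a + \<delta>] =
    [b - 3 \<delta>, b - \<delta>], which leaves a margin \<delta> before the end point.\<close>
  define a where "a = b - 2 * \<delta>"
  define R where "R = (\<lambda>x. (1 / 2) * (S (x - a) + S (x + a)))"
  define r where "r = (\<lambda>x. c * (R x - T x))"
  have R_odd: "R (- x) = - R x" for x
  proof -
    have "S (- x - a) = - S (x + a)" "S (- x + a) = - S (x - a)"
      using S(7)[of "x + a"] S(7)[of "x - a"] by simp_all
    moreover have "1 / 2 * (- y + - z) = - (1 / 2 * (z + y))" for y z :: real by algebra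
    ultimately show ?thesis unfolding R_def by (simp only:)
  qed
  have R_0: "R x = 0" if "\<bar>x\<bar> \<le> a - \<delta>" for x
    using S(9)[of "x - a"] S(8)[of "x + a"] that by (auto simp: R_def)
  have R_1: "R x = 1" if "b - \<delta> < x" for x
    using S(8)[of "x - a"] S(8)[of "x + a"] that \<delta> by (auto simp: R_def a_def)
  have R_le: "\<bar>R x\<bar> \<le> 1" for x
    using S(6)[of "x - a"] S(6)[of "x + a"] by (simp add: R_def)
  have "R \<in> smooth"
    using smooth_cmult[OF smooth.add[OF smooth_affine[OF S(1), of 1 "- a"] smooth_affine[OF S(1), of 1 a]], of "1 / 2"]
    by (simp add: R_def)
  then have r: "r \<in> smooth"
    unfolding r_def by (intro smooth_cmult smooth_diff T(1))
  have r_odd: "r (- x) = - r x" for x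
    by (simp add: r_def R_odd T(7) algebra_simps)
  obtain \<phi> where \<phi>: "\<And>x. (\<phi> has_real_derivative r x) (at x)" "\<phi> b = 0" "\<And>x. \<phi> (- x) = \<phi> x"
    using odd_antiderivative_exists[OF smooth_continuous_on[OF r] r_odd, of b] by blast
  \<comment> \<open>Here T is 1 as well, because b - \<delta> exceeds b / 2 \<ge> e.\<close>
  have r_0: "r x = 0" if "b - \<delta> < x" for x
    using R_1[OF that] T(8)[of x] T(10) that \<delta> by (simp add: r_def)
  have \<phi>_0: "\<phi> x = 0" if "b - \<delta> \<le> x" for x
  proof -
    have "\<phi> x = \<phi> (b - \<delta>)" by (rule DERIV_zero_right_half_line[OF \<phi>(1) r_0 that])
    moreover have "\<phi> b = \<phi> (b - \<delta>)" by (rule DERIV_zero_right_half_line[OF \<phi>(1) r_0]) (use \<delta> in auto)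
    ultimately show ?thesis using \<phi>(2) by simp
  qed
  have test: "\<phi> \<in> test_functions b"
  proof (rule smooth_test_function)
    show "\<phi> \<in> smooth" by (rule smooth.primitive[OF \<phi>(1) r])
    show "b - \<delta> < b" using \<delta> by simp
    show "\<phi> x = 0" if "b - \<delta> < \<bar>x\<bar>" for x
      using \<phi>_0[of x] \<phi>_0[of "- x"] \<phi>(3)[of x] that by (cases "x \<ge> 0") auto
  qed
  have d\<phi>: "deriv \<phi> = r" using \<phi>(1) by (auto intro: DERIV_imp_deriv)
  \<comment> \<open>At least 1 wherever v and r may differ on the interval: near the origin, and
    near the ends where R is switched on. The lengths add up to 8 \<delta>, and \<bar>v - r\<bar>
    \<le> 3 \<bar>c\<bar>, whence 72 = 9 * 8.\<close>
  define h where "h = (\<lambda>x. indicat_real {-\<delta>..\<delta>} x + (indicat_real {b - 3 * \<delta>..b} x + indicat_real {-b..3 * \<delta> - b} x))"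
  have le: "(v x - r x)\<^sup>2 \<le> 9 * c\<^sup>2 * h x" if x: "x \<in> {-b<..<b}" for x
  proof (cases "\<delta> < \<bar>x\<bar> \<and> \<bar>x\<bar> \<le> a - \<delta>")
    case True
    then have "v x - r x = 0" using v(3)[of x] R_0[of x] by (simp add: r_def)
    moreover have "0 \<le> h x" by (simp add: h_def)
    ultimately show ?thesis by simp
  next
    case False
    then have "1 \<le> h x" using x by (auto simp: h_def a_def indicator_def)
    have "\<bar>r x\<bar> \<le> \<bar>c\<bar> * 2"
      unfolding r_def abs_mult using R_le[of x] T(6)[of x] by (intro mult_left_mono) auto
    then have "\<bar>v x - r x\<bar> \<le> 3 * \<bar>c\<bar>" using v(2)[of x] by linarith
    then have "\<bar>v x - r x\<bar>\<^sup>2 \<le> (3 * \<bar>c\<bar>)\<^sup>2" by (intro power_mono) auto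
    then have "(v x - r x)\<^sup>2 \<le> 9 * c\<^sup>2 * 1" by (simp add: power_mult_distrib)
    also have "\<dots> \<le> 9 * c\<^sup>2 * h x" using \<open>1 \<le> h x\<close> by (intro mult_left_mono) auto
    finally show ?thesis .
  qed
  note int = integral_indicator_Icc_le
  have int_h: "integrable (leb_interval b) h"
    unfolding h_def using \<delta> by (intro Bochner_Integration.integrable_add int) auto
  have "integral\<^sup>L (leb_interval b) (\<lambda>x. (v x - r x)\<^sup>2) \<le> integral\<^sup>L (leb_interval b) (\<lambda>x. 9 * c\<^sup>2 * h x)"
  proof (rule integral_mono_AE)
    show "integrable (leb_interval b) (\<lambda>x. (v x - r x)\<^sup>2)"
      using diff_L2[OF v(1) test_function_L2[OF deriv_test_function[OF test]]] by (simp add: L2_iff d\<phi>)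
  qed (use le int_h in \<open>auto intro: AE_I2\<close>)
  also have "\<dots> = 9 * c\<^sup>2 * integral\<^sup>L (leb_interval b) h" by simp
  also have "integral\<^sup>L (leb_interval b) h \<le> 8 * \<delta>"
  proof -
    have "integral\<^sup>L (leb_interval b) h = integral\<^sup>L (leb_interval b) (indicat_real {-\<delta>..\<delta>})
       + (integral\<^sup>L (leb_interval b) (indicat_real {b - 3 * \<delta>..b}) + integral\<^sup>L (leb_interval b) (indicat_real {-b..3 * \<delta> - b}))"
      unfolding h_def using \<delta> int(2) by simp
    then show ?thesis
      using int(1)[of "- \<delta>" \<delta> b] int(1)[of "b - 3 * \<delta>" b b] int(1)[of "- b" "3 * \<delta> - b" b] \<delta> by simp
  qed
  finally have "norm_L2 b (\<lambda>x. v x - deriv \<phi> x) \<le> sqrt (72 * c\<^sup>2 * \<delta>)"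
    by (simp add: norm_L2_eq d\<phi> mult_left_mono)
  then show ?thesis using test by blast
qed

text \<open>A criterion covering both examples: for the tent the mollified sign depends on \<delta>,
  for the smoothed tent it is fixed. Integration by parts makes v the weak derivative, and the
  approximation of v by derivatives of test functions gives membership.\<close>

lemma W012_I:
  assumes b: "0 < b" and v: "v \<in> L2 b" "\<And>x. \<bar>v x\<bar> \<le> \<bar>c\<bar>"
    and T: "\<And>\<delta>. 0 < \<delta> \<Longrightarrow> 4 * \<delta> \<le> b \<Longrightarrow>
      \<exists>e T T'. smooth_sgn e T T' \<and> 2 * e \<le> b \<and> (\<forall>x. \<delta> < \<bar>x\<bar> \<longrightarrow> v x = - c * T x)"
    and u: "continuous_on {-b..b} u" "u (- b) = 0" "u b = 0"
    and S: "finite S" and deriv: "\<And>x. x \<in> {-b<..<b} - S \<Longrightarrow> (u has_real_derivative v x) (at x)"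
  shows "weak_derivative_L2 b u v" "u \<in> W012 b"
proof -
  show weak: "weak_derivative_L2 b u v"
    unfolding weak_derivative_L2_def LINT_leb_interval
    using test_function_integration_by_parts[OF b _ S u(1) deriv v(1)] v(1) by blast
  have "\<exists>\<phi>\<in>test_functions b. norm_L2 b (\<lambda>x. v x - deriv \<phi> x) < \<epsilon>" if "0 < \<epsilon>" for \<epsilon>
  proof -
    \<comment> \<open>Adding 1 keeps k positive even for c = 0; the choice of \<delta> then bounds
      the squared error by \<epsilon>^2 / 2.\<close>
    define k where "k = 72 * c\<^sup>2 + 1"
    define \<delta> where "\<delta> = min (b / 4) (\<epsilon>\<^sup>2 / k / 2)"
    have p: "0 < k" unfolding k_def by (rule add_nonneg_pos) auto
    have \<delta>: "0 < \<delta>" "4 * \<delta> \<le> b" using b that p by (auto simp: \<delta>_def)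
    obtain e T T' where "smooth_sgn e T T'" "2 * e \<le> b" "\<And>x. \<delta> < \<bar>x\<bar> \<Longrightarrow> v x = - c * T x"
      using T[OF \<delta>] by blast
    from test_function_approximation[OF b \<delta> this(1,2) v this(3)]
    obtain \<phi> where "\<phi> \<in> test_functions b" "norm_L2 b (\<lambda>x. v x - deriv \<phi> x) \<le> sqrt (72 * c\<^sup>2 * \<delta>)" by blast
    moreover have "72 * c\<^sup>2 * \<delta> < \<epsilon>\<^sup>2"
    proof -
      have "72 * c\<^sup>2 * \<delta> \<le> k * (\<epsilon>\<^sup>2 / k / 2)"
        using \<delta> by (intro mult_mono) (auto simp: \<delta>_def k_def)
      also have "\<dots> = \<epsilon>\<^sup>2 / 2" using p by simp
      also have "\<dots> < \<epsilon>\<^sup>2" using that by simp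
      finally show ?thesis .
    qed
    then have "sqrt (72 * c\<^sup>2 * \<delta>) < \<epsilon>"
      using that by (intro real_less_lsqrt) auto
    ultimately show ?thesis by (meson order.strict_trans1)
  qed
  then show "u \<in> W012 b" unfolding W012_def using u weak by blast
qed

section \<open>The extremal measure\<close>

lemma tent_extremal:
  fixes b :: real
  assumes b: "0 < b"
  shows "\<exists>V\<in>finite_signed_measures b.
       nontrivial_solution b V (\<lambda>x. 1 - \<bar>x\<bar> / b) \<and> b * norm_M b V = 2"
proof -
  \<comment> \<open>At the origin the slope drops by 2 / b while the tent has the value 1; this
    fixes the point mass.\<close>
  define V :: "real set \<Rightarrow> real" where "V = (\<lambda>A. 2 / b * indicator A 0)"
  define \<mu> :: "real measure" where "\<mu> = density (return (borel_interval b) 0) (\<lambda>_. ennreal (2 / b))"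
  define u where "u = (\<lambda>x::real. 1 - \<bar>x\<bar> / b)"
  define v where "v = (\<lambda>x. - sgn x / b)"
  have em: "emeasure \<mu> A = ennreal (V A)" if "A \<in> sets (borel_interval b)" for A
  proof -
    have "emeasure \<mu> A = ennreal (2 / b) * emeasure (return (borel_interval b) 0) A"
      unfolding \<mu>_def using that by (intro emeasure_density_const) simp
    also have "\<dots> = ennreal (2 / b) * indicator A 0"
      using that by (simp only: emeasure_return)
    also have "\<dots> = ennreal (V A)"
      by (simp add: V_def indicator_def)
    finally show ?thesis .
  qed
  have sets_\<mu>: "sets \<mu> = sets (borel_interval b)" by (simp add: \<mu>_def)
  have fin: "finite_measure \<mu>"
    by (rule finite_measureI) (simp add: sets_eq_imp_space_eq[OF sets_\<mu>] em sets_borel_interval)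
  have V: "V A = measure \<mu> A" if "A \<in> sets (borel_interval b)" for A
    using em[OF that] b by (simp add: measure_def V_def)
  have tv: "total_variation (borel_interval b) V {-b<..<b} = ennreal (2 / b)"
    using total_variation_of_measure[OF fin sets_\<mu> V, of "{-b<..<b}"] em[of "{-b<..<b}"] b
    by (simp add: sets_borel_interval V_def)
  have "V \<in> finite_signed_measures b"
    using signed_measure_of_measure[OF fin sets_\<mu> V] tv by (simp add: finite_signed_measures_def)
  moreover have "b * norm_M b V = 2"
    using b by (simp add: norm_M_def tv)
  moreover have "nontrivial_solution b V u"
  proof -
    have v_le: "\<bar>v x\<bar> \<le> \<bar>1 / b\<bar>" for x
      using b by (simp add: v_def sgn_if)
    have v: "v \<in> L2 b"
      by (rule bounded_in_L2[OF borel_measurable_leb_interval v_le]) (simp add: v_def)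
    have T: "\<exists>e T T'. smooth_sgn e T T' \<and> 2 * e \<le> b \<and> (\<forall>x. \<delta> < \<bar>x\<bar> \<longrightarrow> v x = - (1 / b) * T x)"
      if \<delta>: "0 < \<delta>" "4 * \<delta> \<le> b" for \<delta>
    proof -
      obtain T T' where T: "smooth_sgn \<delta> T T'" using smooth_sgn_exists[OF \<delta>(1)] by blast
      have "v x = - (1 / b) * T x" if "\<delta> < \<bar>x\<bar>" for x
        using smooth_sgnD(8,9)[OF T, of x] that \<delta> by (auto simp: v_def sgn_if)
      then show ?thesis using T \<delta> by (intro exI[of _ \<delta>] exI[of _ T] exI[of _ T']) auto
    qed
    have du: "(u has_real_derivative v x) (at x)" if "x \<in> {-b<..<b} - {0}" for x
    proof -
      \<comment> \<open>Writing \<bar>x\<bar> as x - 2 min x 0 makes the differentiation rule for a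
        frozen function applicable.\<close>
      have "((\<lambda>x. 1 - (x - 2 * min x 0) / b) has_real_derivative
          0 - (1 - 2 * (if x < 0 then 1 else 0)) / b) (at x)"
        by (intro DERIV_diff DERIV_const DERIV_cdivide DERIV_cmult DERIV_ident DERIV_min[of "\<lambda>x. x"]) (use that in auto)
      also have "(\<lambda>x. 1 - (x - 2 * min x 0) / b) = u"
        by (auto simp: u_def min_def fun_eq_iff)
      also have "0 - (1 - 2 * (if x < 0 then 1 else 0)) / b = v x"
        using that by (auto simp: v_def sgn_if)
      finally show ?thesis .
    qed
    have cu: "continuous_on {-b..b} u" unfolding u_def using b by (intro continuous_intros) auto
    have ub: "u (- b) = 0" "u b = 0" and S: "finite {0::real}"
      using b by (simp_all add: u_def)
    note W = W012_I[OF b v v_le T cu ub S du]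
    have "integral\<^sup>L (leb_interval b) (\<lambda>x. v x * deriv \<psi> x) = signed_integral (borel_interval b) V (\<lambda>x. u x * \<psi> x)"
      if \<psi>: "\<psi> \<in> test_functions b" for \<psi>
    proof -
      \<comment> \<open>A primitive of \<open>v x * deriv \<psi> x\<close>: it is (\<psi> x - \<psi>
        0) / b to the left of the origin and the negative of this to the right.\<close>
      define F where "F = (\<lambda>x. (2 * \<psi> (min x 0) - \<psi> x - \<psi> 0) / b)"
      have "integral\<^sup>L (leb_interval b) (\<lambda>x. v x * deriv \<psi> x) = F b - F (- b)"
      proof (rule fundamental_theorem_leb_interval[OF b S])
        show "continuous_on {-b..b} F" unfolding F_def using b
          by (intro continuous_intros test_function_continuous_on[OF \<psi>]
              continuous_on_compose2[OF test_function_continuous_on[OF \<psi>, of UNIV]]) auto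
        show "integrable (leb_interval b) (\<lambda>x. v x * deriv \<psi> x)"
          by (intro integrable_mult_L2 v test_function_L2 deriv_test_function \<psi>)
        fix x assume x: "x \<in> {-b<..<b} - {0::real}"
        have "(F has_real_derivative (2 * (if x < 0 then deriv \<psi> x else 0) - deriv \<psi> x - 0) / b) (at x)"
          unfolding F_def
          by (intro DERIV_cdivide DERIV_diff DERIV_cmult DERIV_const DERIV_min test_function_DERIV[OF \<psi>]) (use x in auto)
        also have "(2 * (if x < 0 then deriv \<psi> x else 0) - deriv \<psi> x - 0) / b = v x * deriv \<psi> x"
          using x by (simp add: v_def sgn_if)
        finally show "(F has_real_derivative v x * deriv \<psi> x) (at x)" .
      qed
      also have "\<dots> = 2 / b * \<psi> 0"
        using b test_function_eq_0[OF \<psi>, of b] test_function_eq_0[OF \<psi>, of "- b"]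
        by (simp add: F_def field_simps)
      also have "\<dots> = integral\<^sup>L \<mu> (\<lambda>x. u x * \<psi> x)"
      proof -
        have [measurable]: "(\<lambda>x. u x * \<psi> x) \<in> borel_measurable (borel_interval b)"
          by (intro borel_measurable_times borel_measurable_continuous_on_restrict
              test_function_continuous_on[OF \<psi>] continuous_on_subset[OF cu]) auto
        have "integral\<^sup>L \<mu> (\<lambda>x. u x * \<psi> x) = (LINT x|return (borel_interval b) 0. 2 / b * (u x * \<psi> x))"
          unfolding \<mu>_def using b by (subst integral_density) auto
        also have "\<dots> = 2 / b * (u 0 * \<psi> 0)"
          using b by (subst integral_return) auto
        finally show ?thesis by (simp add: u_def)
      qed
      also have "\<dots> = signed_integral (borel_interval b) V (\<lambda>x. u x * \<psi> x)"
        using signed_integral_of_measure[OF fin sets_\<mu> V] by simp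
      finally show ?thesis .
    qed
    moreover have "u 0 \<noteq> 0" by (simp add: u_def)
    ultimately show ?thesis
      unfolding nontrivial_solution_def distributional_solution_def LINT_leb_interval
      using W b by (intro conjI bexI[of _ 0] exI[of _ v]) auto
  qed
  ultimately show ?thesis unfolding u_def by blast
qed

section \<open>Smoothed tents\<close>

context
  fixes f :: "real \<Rightarrow> real" and b :: real
  assumes f: "f \<in> borel_measurable borel" "\<And>x. 0 \<le> f x" "integrable (leb_interval b) f"
begin

text \<open>Built over \<open>lborel\<close>, whose measurable sets are the Borel sets of
  \<open>borel_interval b\<close>, whereas f dx is defined with the completion
  \<open>lebesgue\<close>; integrals are transferred between the two.\<close>

private definition \<mu> where "\<mu> = density (restrict_space lborel {-b<..<b}) (\<lambda>x. ennreal (f x))"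

lemma sets_interval_density: "sets \<mu> = sets (borel_interval b)"
  unfolding \<mu>_def sets_density by (intro sets_restrict_space_cong) simp

lemma restrict_measurable: "f \<in> borel_measurable (restrict_space lborel {-b<..<b})"
  using f(1) by (intro measurable_restrict_space1) simp

lemma integrable_lborel:
  assumes "A \<in> sets (borel_interval b)"
  shows "integrable lborel (\<lambda>x. indicat_real A x * f x)"
proof -
  have A: "A \<in> sets borel" "A \<subseteq> {-b<..<b}" using assms by (auto simp: sets_borel_interval)
  have "set_integrable lebesgue A f"
    by (rule set_integrable_subset[OF f(3)[folded set_integrable_leb_interval]]) (use A in auto)
  then have "integrable lebesgue (\<lambda>x. indicat_real A x * f x)" by (simp add: set_integrable_def)
  moreover have "(\<lambda>x. indicat_real A x * f x) \<in> borel_measurable lborel"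
    using f(1) A(1) by simp
  ultimately show ?thesis by (simp add: integrable_completion)
qed

lemma emeasure_density_eq:
  assumes "A \<in> sets (borel_interval b)"
  shows "emeasure \<mu> A = ennreal (density_signed_measure f A)"
proof -
  have A: "A \<in> sets borel" "A \<subseteq> {-b<..<b}" using assms by (auto simp: sets_borel_interval)
  have "emeasure \<mu> A = (\<integral>\<^sup>+x. ennreal (f x) * indicator A x \<partial>restrict_space lborel {-b<..<b})"
    unfolding \<mu>_def using assms restrict_measurable
    by (intro emeasure_density) (auto simp: sets_restrict_space)
  also have "\<dots> = (\<integral>\<^sup>+x. ennreal (f x) * indicator A x * indicator {-b<..<b} x \<partial>lborel)"
    by (subst nn_integral_restrict_space) simp_all
  also have "\<dots> = (\<integral>\<^sup>+x. ennreal (indicat_real A x * f x) \<partial>lborel)"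
    using A(2) by (intro nn_integral_cong) (auto split: split_indicator)
  also have "\<dots> = ennreal (integral\<^sup>L lborel (\<lambda>x. indicat_real A x * f x))"
    using integrable_lborel[OF assms] f(2) by (intro nn_integral_eq_integral) auto
  also have "integral\<^sup>L lborel (\<lambda>x. indicat_real A x * f x) = density_signed_measure f A"
    unfolding density_signed_measure_def set_lebesgue_integral_def
    using f(1) A(1) by (subst integral_completion) simp_all
  finally show ?thesis .
qed

lemma density_nonneg: "0 \<le> density_signed_measure f A"
  using f(2) by (simp add: density_signed_measure_def set_lebesgue_integral_def)

lemma finite_measure_density: "finite_measure \<mu>"
proof (rule finite_measureI)
  have sp: "space \<mu> = {-b<..<b}"
    using sets_eq_imp_space_eq[OF sets_interval_density] by simp
  show "emeasure \<mu> (space \<mu>) \<noteq> \<infinity>"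
    unfolding sp by (subst emeasure_density_eq) (simp_all add: sets_borel_interval)
qed

lemma measure_density_eq:
  "A \<in> sets (borel_interval b) \<Longrightarrow> density_signed_measure f A = measure \<mu> A"
  using emeasure_density_eq[of A] density_nonneg[of A] by (simp add: measure_def)

lemma norm_M_density: "norm_M b (density_signed_measure f) = integral\<^sup>L (leb_interval b) f"
proof -
  have I: "{-b<..<b} \<in> sets (borel_interval b)" by (simp add: sets_borel_interval)
  have "total_variation (borel_interval b) (density_signed_measure f) {-b<..<b} = emeasure \<mu> {-b<..<b}"
    by (rule total_variation_of_measure[OF finite_measure_density sets_interval_density measure_density_eq I])
  then have "norm_M b (density_signed_measure f) = density_signed_measure f {-b<..<b}"
    using density_nonneg by (simp add: norm_M_def emeasure_density_eq[OF I])
  also have "\<dots> = integral\<^sup>L (leb_interval b) f"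
    by (simp add: density_signed_measure_def LINT_leb_interval)
  finally show ?thesis .
qed

lemma signed_integral_density:
  assumes g: "g \<in> borel_measurable borel"
  shows "signed_integral (borel_interval b) (density_signed_measure f) g = integral\<^sup>L (leb_interval b) (\<lambda>x. f x * g x)"
proof -
  have "signed_integral (borel_interval b) (density_signed_measure f) g = integral\<^sup>L \<mu> g"
    by (rule signed_integral_of_measure[OF finite_measure_density sets_interval_density measure_density_eq])
  also have "\<dots> = integral\<^sup>L (restrict_space lborel {-b<..<b}) (\<lambda>x. f x *\<^sub>R g x)"
    unfolding \<mu>_def
  proof (rule integral_density)
    show "g \<in> borel_measurable (restrict_space lborel {-b<..<b})"
      using g by (intro measurable_restrict_space1) simp
  qed (use restrict_measurable f(2) in auto)
  also have "\<dots> = integral\<^sup>L lborel (\<lambda>x. indicat_real {-b<..<b} x *\<^sub>R (f x *\<^sub>R g x))"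
    by (subst integral_restrict_space) simp_all
  also have "\<dots> = integral\<^sup>L lebesgue (\<lambda>x. indicat_real {-b<..<b} x *\<^sub>R (f x *\<^sub>R g x))"
    using f(1) g by (subst integral_completion) simp_all
  also have "\<dots> = integral\<^sup>L (leb_interval b) (\<lambda>x. f x * g x)"
    by (subst integral_restrict_space) simp_all
  finally show ?thesis .
qed

end

text \<open>The tent is scaled to slopes 1 and - 1, and its slope is replaced by - T. Then - u'' =
  T', so the potential is T' / u; as T' has mass 2 and lives where u \<ge> b - 3 e, the norm bound
  follows.\<close>

lemma smoothed_tent:
  assumes b: "0 < b" and e: "0 < e" "6 * e \<le> b"
  shows "\<exists>f\<in>L1 b. \<exists>u. nontrivial_solution b (density_signed_measure f) u \<and>
    b * norm_M b (density_signed_measure f) \<le> 2 * b / (b - 3 * e)"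
proof -
  obtain T T' where TT: "smooth_sgn e T T'" using smooth_sgn_exists[OF e(1)] by blast
  note T = smooth_sgnD[OF TT]
  obtain u where du: "\<And>x. (u has_real_derivative - T x) (at x)" and ub: "u b = 0" and even: "\<And>x. u (- x) = u x"
    using odd_antiderivative_exists[OF smooth_continuous_on[OF smooth_minus[OF T(1)]], of b] T(7) by auto
  have cu: "continuous_on A u" for A
    by (rule DERIV_continuous_on[OF has_field_derivative_at_within[OF du]])
  have u_eq: "u x = b - x" if "e \<le> x" for x
  proof -
    have D: "((\<lambda>x. u x + x) has_real_derivative - T y + 1) (at y)" for y
      by (intro DERIV_add du DERIV_ident)
    have Z: "- T y + 1 = 0" if "e < y" for y using T(8)[of y] that by simp
    have "u x + x = u e + e" by (rule DERIV_zero_right_half_line[OF D Z that])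
    moreover have "u b + b = u e + e" by (rule DERIV_zero_right_half_line[OF D Z]) (use e in auto)
    ultimately show ?thesis using ub by simp
  qed
  \<comment> \<open>The slope - T is at most 1, so on [-e, e] one has u x \<ge> u e - (e - x) \<ge>
    (b - e) - 2 e.\<close>
  have u_ge: "b - 3 * e \<le> u x" if "\<bar>x\<bar> \<le> e" for x
  proof -
    have "x - u x \<le> e - u e"
    proof (rule DERIV_nonneg_imp_nondecreasing[of x e "\<lambda>x. x - u x"])
      show "x \<le> e" using that by simp
      show "\<exists>y. ((\<lambda>x. x - u x) has_real_derivative y) (at z) \<and> 0 \<le> y" for z
        using T(6)[of z] by (intro exI[of _ "1 - - T z"] conjI DERIV_diff du DERIV_ident) auto
    qed
    then show ?thesis using u_eq[of e] that by simp
  qed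
  have pos: "0 < b - 3 * e" using e b by simp
  define f where "f = (\<lambda>x. T' x / u x)"
  \<comment> \<open>Outside [-e, e], where u may vanish, T' is zero, so division by 0 does no
    harm.\<close>
  have fu: "f x * u x = T' x" for x
    using T(5)[of x] u_ge[of x] pos by (cases "e < \<bar>x\<bar>") (auto simp: f_def)
  have f_le: "f x \<le> T' x / (b - 3 * e)" and f_nonneg: "0 \<le> f x" for x
    using T(5)[of x] T(4)[of x] u_ge[of x] pos by (cases "e < \<bar>x\<bar>"; auto simp: f_def intro!: divide_left_mono)+
  have cT': "continuous_on A T'" for A using T(2) by (rule smooth_continuous_on)
  have bu: "u \<in> borel_measurable borel" and bT': "T' \<in> borel_measurable borel"
    using cu cT' by (auto intro: borel_measurable_continuous_onI)
  have bf: "f \<in> borel_measurable borel" unfolding f_def using bu bT' by measurable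
  have T'_int: "integrable (leb_interval b) T'"
    using integrable_mult_L2[OF continuous_on_L2[OF continuous_on_const[of _ 1]] continuous_on_L2[OF cT']] by simp
  have f_int: "integrable (leb_interval b) f"
  proof (rule Bochner_Integration.integrable_bound)
    show "integrable (leb_interval b) (\<lambda>x. T' x / (b - 3 * e))" using T'_int by simp
    show "f \<in> borel_measurable (leb_interval b)" by (rule borel_measurable_leb_interval[OF bf])
    show "AE x in leb_interval b. norm (f x) \<le> norm (T' x / (b - 3 * e))"
      using f_le f_nonneg T(4) pos by (intro AE_I2) simp
  qed
  have "integral\<^sup>L (leb_interval b) f \<le> integral\<^sup>L (leb_interval b) (\<lambda>x. T' x / (b - 3 * e))"
    using f_le f_int T'_int by (intro integral_mono) auto
  also have "\<dots> = 2 / (b - 3 * e)"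
    using fundamental_theorem_leb_interval[OF b finite.emptyI smooth_continuous_on[OF T(1)] T(3) T'_int]
      T(8)[of b] T(9)[of "- b"] e by simp
  finally have "b * norm_M b (density_signed_measure f) \<le> b * (2 / (b - 3 * e))"
    unfolding norm_M_density[OF bf f_nonneg f_int] using b by (intro mult_left_mono) auto
  moreover have "f \<in> L1 b" using f_int by (simp add: L1_def set_integrable_leb_interval)
  moreover have "nontrivial_solution b (density_signed_measure f) u"
  proof -
    let ?v = "\<lambda>x. - T x"
    have v: "?v \<in> L2 b" by (rule continuous_on_L2[OF smooth_continuous_on[OF smooth_minus[OF T(1)]]])
    have v_le: "\<bar>- T x\<bar> \<le> \<bar>1\<bar>" for x using T(6) by simp
    have ex: "\<exists>e T1 T1'. smooth_sgn e T1 T1' \<and> 2 * e \<le> b \<and> (\<forall>x. \<delta> < \<bar>x\<bar> \<longrightarrow> - T x = - 1 * T1 x)" for \<delta> :: real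
      using TT e by (intro exI[of _ e] exI[of _ T] exI[of _ T']) auto
    have umb: "u (- b) = 0" using even ub by simp
    note W = W012_I[OF b v v_le ex cu umb ub finite.emptyI du]
    have "integral\<^sup>L (leb_interval b) (\<lambda>x. - T x * deriv \<psi> x) =
        signed_integral (borel_interval b) (density_signed_measure f) (\<lambda>x. u x * \<psi> x)"
      if \<psi>: "\<psi> \<in> test_functions b" for \<psi>
    proof -
      have b\<psi>: "\<psi> \<in> borel_measurable borel"
        by (rule borel_measurable_continuous_onI[OF test_function_continuous_on[OF \<psi>]])
      have "integral\<^sup>L (leb_interval b) (\<lambda>x. - T x * deriv \<psi> x) = - integral\<^sup>L (leb_interval b) (\<lambda>x. - T' x * \<psi> x)"
        by (rule test_function_integration_by_parts[OF b \<psi> finite.emptyI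
              smooth_continuous_on[OF smooth_minus[OF T(1)]] DERIV_minus[OF T(3)]
              continuous_on_L2[OF smooth_continuous_on[OF smooth_minus[OF T(2)]]]])
      also have "\<dots> = integral\<^sup>L (leb_interval b) (\<lambda>x. f x * (u x * \<psi> x))"
        by (simp add: mult.assoc[symmetric] fu)
      also have "\<dots> = signed_integral (borel_interval b) (density_signed_measure f) (\<lambda>x. u x * \<psi> x)"
        using bu b\<psi> by (subst signed_integral_density[OF bf f_nonneg f_int]) auto
      finally show ?thesis .
    qed
    moreover have "u 0 \<noteq> 0" using u_ge[of 0] pos e by simp
    ultimately show ?thesis
      unfolding nontrivial_solution_def distributional_solution_def LINT_leb_interval
      using W b by (intro conjI bexI[of _ 0] exI[of _ ?v]) auto
  qed
  ultimately show ?thesis by (auto intro!: bexI[of _ f] exI[of _ u] simp: mult.commute)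
qed

section \<open>Sharpness of the constant 2 for integrable potentials\<close>

lemma lower_bound_sharp:
  assumes b: "0 < b"
  shows "\<not> (\<exists>C>2. \<forall>f\<in>L1 b. \<forall>u. nontrivial_solution b (density_signed_measure f) u \<longrightarrow>
       b * norm_M b (density_signed_measure f) \<ge> C)"
proof
  assume "\<exists>C>2. \<forall>f\<in>L1 b. \<forall>u. nontrivial_solution b (density_signed_measure f) u \<longrightarrow>
       b * norm_M b (density_signed_measure f) \<ge> C"
  then obtain C where C: "C > 2" "\<And>f u. f \<in> L1 b \<Longrightarrow> nontrivial_solution b (density_signed_measure f) u \<Longrightarrow>
       b * norm_M b (density_signed_measure f) \<ge> C" by blast
  \<comment> \<open>Chosen so that C (b - 3 e) = (C + 2) b / 2, which exceeds 2 b precisely because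
    C > 2.\<close>
  define e where "e = (C - 2) * b / (6 * C)"
  have e: "0 < e" "6 * e \<le> b" using C(1) b by (auto simp: e_def field_simps)
  obtain f u where "f \<in> L1 b" "nontrivial_solution b (density_signed_measure f) u"
    "b * norm_M b (density_signed_measure f) \<le> 2 * b / (b - 3 * e)"
    using smoothed_tent[OF b e] by blast
  then have "C \<le> 2 * b / (b - 3 * e)" using C(2)[of f u] by linarith
  moreover have "0 < b - 3 * e" using e b by simp
  ultimately have "C * (b - 3 * e) \<le> 2 * b" by (simp add: field_simps)
  moreover have "C * (b - 3 * e) = C * b - (C - 2) * b / 2"
    using C(1) by (simp add: e_def field_simps)
  moreover have "0 < (C - 2) * b" using C(1) b by simp
  ultimately show False by (simp add: field_simps)
qed

theorem theorem4p1:
  fixes b :: real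
  assumes "b > 0"
  shows "(\<forall>V\<in>finite_signed_measures b. \<forall>u. nontrivial_solution b V u \<longrightarrow> b * norm_M b V \<ge> 2) \<and>
    (\<exists>V\<in>finite_signed_measures b.
       nontrivial_solution b V (\<lambda>x. 1 - \<bar>x\<bar> / b) \<and> b * norm_M b V = 2) \<and>
    (\<forall>f\<in>L1 b. \<forall>u. nontrivial_solution b (density_signed_measure f) u \<longrightarrow>
       b * norm_M b (density_signed_measure f) \<noteq> 2) \<and>
    \<not> (\<exists>C>2. \<forall>f\<in>L1 b. \<forall>u. nontrivial_solution b (density_signed_measure f) u \<longrightarrow>
       b * norm_M b (density_signed_measure f) \<ge> C)"
proof (intro conjI ballI allI impI)
  show "2 \<le> b * norm_M b V" if "V \<in> finite_signed_measures b" "nontrivial_solution b V u" for V u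
    using assms that by (rule norm_M_ge)
  show "\<exists>V\<in>finite_signed_measures b. nontrivial_solution b V (\<lambda>x. 1 - \<bar>x\<bar> / b) \<and> b * norm_M b V = 2"
    using assms by (rule tent_extremal)
  show "b * norm_M b (density_signed_measure f) \<noteq> 2"
    if "f \<in> L1 b" "nontrivial_solution b (density_signed_measure f) u" for f u
    using assms density_signed_measure_finite[OF that(1)] that(2) density_total_variation_singleton
    by (rule norm_M_neq)
  show "\<not> (\<exists>C>2. \<forall>f\<in>L1 b. \<forall>u. nontrivial_solution b (density_signed_measure f) u \<longrightarrow>
       b * norm_M b (density_signed_measure f) \<ge> C)"
    using assms by (rule lower_bound_sharp)
qed

end
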